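(* Let $(M,g)$ be a pseudo-Riemannian manifold which is decomposable by a Lie group $\Sigma$, with associated pseudo-Riemannian submersion $\pi:(M,g)\to(I,\tilde\varepsilon\,ds^2)$ and associated function $h:I\to\mathbb{R}$. Let $\varepsilon'\in\{1,-1\}$, let $f:I\to\mathbb{R}$ be a smooth function, put $u=f\circ\pi$, and let $F:M\to(M\times\mathbb{R},\langle\,,\rangle=g+\varepsilon'dt^2)$, $F(x)=(x,u(x))$, be the graph map of $u$. Assume that $F$ is non-degenerate, with $\varepsilon=\mathrm{sign}(\varepsilon'+\tilde\varepsilon (f'\circ\pi)^2)=\pm1$ constant. Then $F$ is a $\Sigma$-invariant translating soliton if, and only if, $f$ is a solution to $$f''(s)=\big(\tilde\varepsilon+\varepsilon'(f'(s))^2\big)\big(1-f'(s)h(s)\big).$$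
   Context: Decomposable: $\Sigma$ is a Lie group acting properly by isometries on $(M,g)$, all orbits have codimension one, the orbit space $M/\Sigma$ is identified with an open interval $I$, and the projection $\pi:M\to I$ is a pseudo-Riemannian submersion onto $(I,\tilde\varepsilon\,ds^2)$, where $\tilde\varepsilon=g(\nabla\pi,\nabla\pi)\in\{1,-1\}$ is constant. The fibers $\pi^{-1}(s)$ are the orbits of $\Sigma$, and each has constant mean curvature $h(s)$ with respect to the unit normal $-\nabla\pi$; this defines the associated smooth function $h:I\to\mathbb{R}$. Moreover, for one of the stabilizers $\Sigma_o$ there is a unit curve $\beta:I\to M$ orthogonal to all orbits such that $\phi:I\times(\Sigma/\Sigma_o)\to M$, $\phi(s,[\sigma])=\sigma\cdot\beta(s)$, is a (well-defined) diffeomorphism with $\pi\circ\phi(s,[\sigma])=s$. Mean curvature conventions: for a non-degenerate hypersurface with unit normal $\nu$, $\langle\nu,\nu\rangle=\varepsilon=\pm1$, the mean curvature vector $\vec H$ is the (unnormalized) trace of the second fundamental form with respect to the induced metric, and the mean curvature function $H$ with respect to $\nu$ is defined by $\vec H=\varepsilon H\nu$. With these conventions $\mathrm{div}(\nabla\pi)=h\circ\pi$. $F$ is a translating soliton if it is non-degenerate and $\vec H=\partial_t^\perp$, where $\partial_t^\perp$ is the component of $\partial_t$ normal to $F$. A function $u:M\to\mathbb{R}$ is $\Sigma$-invariant if $u(\sigma\cdot x)=u(x)$ for all $x\in M$, $\sigma\in\Sigma$; a graphical translating soliton is $\Sigma$-invariant if its graph is invariant under the action $\sigma\cdot(x,t)=(\sigma\cdot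 x,t)$ of $\Sigma$ on $M\times\mathbb{R}$. *)

theory Defs
  imports "HOL-Analysis.Analysis" "HOL-Algebra.Group_Action" "HOL-Algebra.Left_Coset"
begin

section \<open>Smooth maps between normed spaces\<close>

text \<open>
  Only used on open sets of finite-dimensional spaces, where "all iterated directional
  derivatives exist as Frechet derivatives and are continuous" is the usual notion.
\<close>

primrec Ck_on :: "nat \<Rightarrow> 'a::real_normed_vector set \<Rightarrow> ('a \<Rightarrow> 'b::real_normed_vector) \<Rightarrow> bool" where
  "Ck_on 0 S f \<longleftrightarrow> continuous_on S f"
| "Ck_on (Suc k) S f \<longleftrightarrow> (\<forall>x\<in>S. f differentiable (at x)) \<and>
     (\<forall>v. Ck_on k S (\<lambda>x. frechet_derivative f (at x) v))"

definition smooth_on :: "'a::real_normed_vector set \<Rightarrow> ('a \<Rightarrow> 'b::real_normed_vector) \<Rightarrow> bool" where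
  "smooth_on S f \<longleftrightarrow> (\<forall>k. Ck_on k S f)"

section \<open>Manifolds\<close>

text \<open>
  A manifold is given by an atlas. The model space is a finite-dimensional normed space and not
  a type of class \<open>euclidean_space\<close>, because manifolds of dimension 0 must be allowed
  (discrete groups, and orbits in a one-dimensional manifold).
\<close>

type_synonym ('a, 'e) chart = "'a set \<times> ('a \<Rightarrow> 'e)"

definition cinv :: "('a, 'e) chart \<Rightarrow> 'e \<Rightarrow> 'a" where
  "cinv c = inv_into (fst c) (snd c)"

definition local_rep :: "('a, 'e) chart \<Rightarrow> ('b, 'f) chart \<Rightarrow> ('a \<Rightarrow> 'b) \<Rightarrow> 'e \<Rightarrow> 'f" where
  "local_rep c d F = snd d \<circ> F \<circ> cinv c"

definition mcarrier :: "('a, 'e) chart set \<Rightarrow> 'a set" where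
  "mcarrier A = (\<Union>c\<in>A. fst c)"

definition smooth_atlas :: "('a, 'e::real_normed_vector) chart set \<Rightarrow> bool" where
  "smooth_atlas A \<longleftrightarrow>
     (\<forall>c\<in>A. inj_on (snd c) (fst c) \<and> open (snd c ` fst c)) \<and>
     (\<forall>c\<in>A. \<forall>d\<in>A. open (snd c ` (fst c \<inter> fst d)) \<and>
        smooth_on (snd c ` (fst c \<inter> fst d)) (local_rep c d id))"

definition mtop :: "('a, 'e::real_normed_vector) chart set \<Rightarrow> 'a topology" where
  "mtop A = topology (\<lambda>W. W \<subseteq> mcarrier A \<and> (\<forall>c\<in>A. open (snd c ` (W \<inter> fst c))))"

definition smooth_manifold :: "('a, 'e::real_normed_vector) chart set \<Rightarrow> bool" where
  "smooth_manifold A \<longleftrightarrow>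
     (\<exists>B::'e set. finite B \<and> span B = UNIV) \<and> smooth_atlas A \<and>
     Hausdorff_space (mtop A) \<and> second_countable (mtop A)"

lemma openin_mtop:
  assumes "smooth_atlas A"
  shows "openin (mtop A) W \<longleftrightarrow> W \<subseteq> mcarrier A \<and> (\<forall>c\<in>A. open (snd c ` (W \<inter> fst c)))"
proof -
  have inj: "inj_on (snd c) (fst c)" if "c \<in> A" for c
    using assms that by (auto simp: smooth_atlas_def)
  have Int: "snd c ` (S \<inter> T \<inter> fst c) = snd c ` (S \<inter> fst c) \<inter> snd c ` (T \<inter> fst c)"
    if "c \<in> A" for c S T
    using inj[OF that] by (auto simp: inj_on_def)
  have Un: "snd c ` (\<Union>K \<inter> fst c) = (\<Union>S\<in>K. snd c ` (S \<inter> fst c))" for c :: "('a, 'b) chart" and K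
    by auto
  have "istopology (\<lambda>W. W \<subseteq> mcarrier A \<and> (\<forall>c\<in>A. open (snd c ` (W \<inter> fst c))))"
    unfolding istopology_def by (auto simp: Int Un intro!: open_Int open_UN)
  then show ?thesis
    by (simp add: mtop_def)
qed

definition interval_atlas :: "real set \<Rightarrow> (real, real) chart set" where
  "interval_atlas I = {(I, id)}"

definition prod_atlas :: "('a, 'e) chart set \<Rightarrow> ('b, 'f) chart set \<Rightarrow> ('a \<times> 'b, 'e \<times> 'f) chart set" where
  "prod_atlas A B = {(fst c \<times> fst d, map_prod (snd c) (snd d)) | c d. c \<in> A \<and> d \<in> B}"

definition smooth_map :: "('a, 'e::real_normed_vector) chart set \<Rightarrow>
    ('b, 'f::real_normed_vector) chart set \<Rightarrow> ('a \<Rightarrow> 'b) \<Rightarrow> bool" where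
  "smooth_map A B F \<longleftrightarrow> F \<in> mcarrier A \<rightarrow> mcarrier B \<and>
     (\<forall>c\<in>A. \<forall>d\<in>B. open (snd c ` (fst c \<inter> F -` fst d)) \<and>
        smooth_on (snd c ` (fst c \<inter> F -` fst d)) (local_rep c d F))"

definition diffeomorphism :: "('a, 'e::real_normed_vector) chart set \<Rightarrow>
    ('b, 'f::real_normed_vector) chart set \<Rightarrow> ('a \<Rightarrow> 'b) \<Rightarrow> bool" where
  "diffeomorphism A B F \<longleftrightarrow> bij_betw F (mcarrier A) (mcarrier B) \<and>
     smooth_map A B F \<and> smooth_map B A (inv_into (mcarrier A) F)"

section \<open>Pseudo-Riemannian metrics\<close>

text \<open>
  Tangent vectors at \<open>x\<close> are represented by their components, elements of the model space, in
  each chart about \<open>x\<close>; a tensor field assigns to every chart its components in that chart, and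
  equations between tangent vectors are required in every chart. The differential of \<open>F\<close> at
  \<open>x\<close>, in charts \<open>c\<close> about \<open>x\<close> and \<open>d\<close> about \<open>F x\<close>, is \<open>dmap c d F x\<close>.
\<close>

definition dmap :: "('a, 'e::real_normed_vector) chart \<Rightarrow> ('b, 'f::real_normed_vector) chart \<Rightarrow>
    ('a \<Rightarrow> 'b) \<Rightarrow> 'a \<Rightarrow> 'e \<Rightarrow> 'f" where
  "dmap c d F x = frechet_derivative (local_rep c d F) (at (snd c x))"

type_synonym ('a, 'e) metric = "('a, 'e) chart \<Rightarrow> 'a \<Rightarrow> 'e \<Rightarrow> 'e \<Rightarrow> real"

definition nondegenerate_on :: "'e::real_vector set \<Rightarrow> ('e \<Rightarrow> 'e \<Rightarrow> real) \<Rightarrow> bool" where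
  "nondegenerate_on V b \<longleftrightarrow> (\<forall>v\<in>V. (\<forall>w\<in>V. b v w = 0) \<longrightarrow> v = 0)"

definition pseudo_riemannian_metric ::
    "('a, 'e::real_normed_vector) chart set \<Rightarrow> ('a, 'e) metric \<Rightarrow> bool" where
  "pseudo_riemannian_metric A g \<longleftrightarrow>
     (\<forall>c\<in>A. \<forall>x\<in>fst c. bilinear (g c x) \<and> (\<forall>v w. g c x v w = g c x w v) \<and>
        nondegenerate_on UNIV (g c x)) \<and>
     (\<forall>c\<in>A. \<forall>v w. smooth_on (snd c ` fst c) (\<lambda>p. g c (cinv c p) v w)) \<and>
     (\<forall>c\<in>A. \<forall>d\<in>A. \<forall>x\<in>fst c \<inter> fst d. \<forall>v w.
        g c x v w = g d x (dmap c d id x v) (dmap c d id x w))"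

definition pseudo_riemannian_manifold ::
    "('a, 'e::real_normed_vector) chart set \<Rightarrow> ('a, 'e) metric \<Rightarrow> bool" where
  "pseudo_riemannian_manifold A g \<longleftrightarrow> smooth_manifold A \<and> pseudo_riemannian_metric A g"

text \<open>\<open>e ds\<^sup>2\<close> on an interval:\<close>

definition line_metric :: "real \<Rightarrow> (real, real) metric" where
  "line_metric e = (\<lambda>c s a b. e * a * b)"

definition pullback_at :: "('b, 'f::real_normed_vector) metric \<Rightarrow>
    ('a, 'e::real_normed_vector) chart \<Rightarrow> ('b, 'f) chart \<Rightarrow> ('a \<Rightarrow> 'b) \<Rightarrow> 'a \<Rightarrow> 'e \<Rightarrow> 'e \<Rightarrow> real" where
  "pullback_at k c d F x v w = k d (F x) (dmap c d F x v) (dmap c d F x w)"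

text \<open>The value does not depend on the chosen chart, by the transformation law of \<open>k\<close>.\<close>

definition pullback :: "('b, 'f::real_normed_vector) chart set \<Rightarrow> ('b, 'f) metric \<Rightarrow>
    ('a \<Rightarrow> 'b) \<Rightarrow> ('a, 'e::real_normed_vector) metric" where
  "pullback B k F c x = pullback_at k c (SOME d. d \<in> B \<and> F x \<in> fst d) F x"

text \<open>The product of a manifold with the real line, with the metric \<open>g + e dt\<^sup>2\<close>.\<close>

definition times_line :: "('a, 'e::real_normed_vector) chart set \<Rightarrow> ('a \<times> real, 'e \<times> real) chart set" where
  "times_line A = prod_atlas A (interval_atlas UNIV)"

definition times_line_metric :: "('a, 'e::real_normed_vector) chart set \<Rightarrow> ('a, 'e) metric \<Rightarrow>
    real \<Rightarrow> ('a \<times> real, 'e \<times> real) metric" where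
  "times_line_metric A g e = (\<lambda>c p v w.
     pullback A g fst c p v w + pullback (interval_atlas UNIV) (line_metric e) snd c p v w)"

definition grad :: "('a, 'e::real_normed_vector) metric \<Rightarrow> ('a, 'e) chart \<Rightarrow> ('a \<Rightarrow> real) \<Rightarrow> 'a \<Rightarrow> 'e" where
  "grad g c f x =
     (THE v. \<forall>w. g c x v w = frechet_derivative (f \<circ> cinv c) (at (snd c x)) w)"

definition pseudo_riemannian_submersion ::
    "('a, 'e::real_normed_vector) chart set \<Rightarrow> ('a, 'e) metric \<Rightarrow>
     ('b, 'f::real_normed_vector) chart set \<Rightarrow> ('b, 'f) metric \<Rightarrow> ('a \<Rightarrow> 'b) \<Rightarrow> bool" where
  "pseudo_riemannian_submersion A g B k P \<longleftrightarrow>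
     smooth_map A B P \<and> P ` mcarrier A = mcarrier B \<and>
     (\<forall>c\<in>A. \<forall>d\<in>B. \<forall>x\<in>fst c \<inter> P -` fst d.
        let V = {v. dmap c d P x v = 0}; H = {v. \<forall>w\<in>V. g c x v w = 0} in
          surj (dmap c d P x) \<and> nondegenerate_on V (g c x) \<and>
          (\<forall>v\<in>H. \<forall>w\<in>H. pullback_at k c d P x v w = g c x v w))"

section \<open>Levi-Civita connection and mean curvature\<close>

definition metric_deriv :: "('a, 'e::real_normed_vector) metric \<Rightarrow> ('a, 'e) chart \<Rightarrow> 'a \<Rightarrow>
    'e \<Rightarrow> 'e \<Rightarrow> 'e \<Rightarrow> real" where
  "metric_deriv g c x u v w = frechet_derivative (\<lambda>p. g c (cinv c p) v w) (at (snd c x)) u"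

text \<open>Christoffel symbols of the Levi-Civita connection, as a bilinear map of the model space.\<close>

definition christoffel :: "('a, 'e::real_normed_vector) metric \<Rightarrow> ('a, 'e) chart \<Rightarrow> 'a \<Rightarrow> 'e \<Rightarrow> 'e \<Rightarrow> 'e" where
  "christoffel g c x v w = (THE y. \<forall>z. g c x y z =
     (metric_deriv g c x v w z + metric_deriv g c x w v z - metric_deriv g c x z v w) / 2)"

text \<open>
  Levi-Civita derivative in direction \<open>v\<close> of a vector field \<open>Y\<close> along \<open>F\<close>, where \<open>Y y\<close> are
  the components in \<open>d\<close> of a tangent vector at \<open>F y\<close>.
\<close>

definition cov_along :: "('b, 'f::real_normed_vector) metric \<Rightarrow> ('a, 'e::real_normed_vector) chart \<Rightarrow>
    ('b, 'f) chart \<Rightarrow> ('a \<Rightarrow> 'b) \<Rightarrow> ('a \<Rightarrow> 'f) \<Rightarrow> 'a \<Rightarrow> 'e \<Rightarrow> 'f" where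
  "cov_along k c d F Y x v = frechet_derivative (Y \<circ> cinv c) (at (snd c x)) v +
     christoffel k d (F x) (dmap c d F x v) (Y x)"

definition normal_part :: "('f::real_vector \<Rightarrow> 'f \<Rightarrow> real) \<Rightarrow> 'f set \<Rightarrow> 'f \<Rightarrow> 'f" where
  "normal_part b T v = (THE n. (\<forall>t\<in>T. b n t = 0) \<and> v - n \<in> T)"

definition nondegenerate_immersion ::
    "('a, 'e::real_normed_vector) chart set \<Rightarrow> ('b, 'f::real_normed_vector) chart set \<Rightarrow>
     ('b, 'f) metric \<Rightarrow> ('a \<Rightarrow> 'b) \<Rightarrow> bool" where
  "nondegenerate_immersion A B k F \<longleftrightarrow> smooth_map A B F \<and>
     (\<forall>c\<in>A. \<forall>d\<in>B. \<forall>x\<in>fst c \<inter> F -` fst d.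
        inj (dmap c d F x) \<and> nondegenerate_on UNIV (pullback_at k c d F x))"

text \<open>
  Normal part of the covariant derivative of \<open>dF(w)\<close>, where \<open>w\<close> is extended to a vector field
  with constant components in \<open>c\<close>.
\<close>

definition second_fundamental_form :: "('b, 'f::real_normed_vector) metric \<Rightarrow>
    ('a, 'e::real_normed_vector) chart \<Rightarrow> ('b, 'f) chart \<Rightarrow> ('a \<Rightarrow> 'b) \<Rightarrow> 'a \<Rightarrow> 'e \<Rightarrow> 'e \<Rightarrow> 'f" where
  "second_fundamental_form k c d F x v w =
     normal_part (k d (F x)) (range (dmap c d F x)) (cov_along k c d F (\<lambda>y. dmap c d F y w) x v)"

text \<open>
  Trace of a bilinear map \<open>B\<close> with respect to a non-degenerate form \<open>b\<close>: the sum of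
  \<open>B e e'\<close> over a basis, \<open>e'\<close> being the element of the \<open>b\<close>-dual basis belonging to \<open>e\<close>
  (in indices, \<open>b\<^sup>i\<^sup>j B\<^sub>i\<^sub>j\<close>); it does not depend on the basis.
\<close>

definition form_trace :: "('e::real_vector \<Rightarrow> 'e \<Rightarrow> real) \<Rightarrow> ('e \<Rightarrow> 'e \<Rightarrow> 'f::real_vector) \<Rightarrow> 'f" where
  "form_trace b B = (let E = (SOME E. independent E \<and> span E = UNIV) in
     \<Sum>e\<in>E. B e (THE e'. \<forall>u\<in>E. b e' u = (if u = e then 1 else 0)))"

definition mean_curvature_vector :: "('b, 'f::real_normed_vector) metric \<Rightarrow>
    ('a, 'e::real_normed_vector) chart \<Rightarrow> ('b, 'f) chart \<Rightarrow> ('a \<Rightarrow> 'b) \<Rightarrow> 'a \<Rightarrow> 'f" where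
  "mean_curvature_vector k c d F x =
     form_trace (pullback_at k c d F x) (second_fundamental_form k c d F x)"

text \<open>
  \<open>F\<close> is a non-degenerate hypersurface whose mean curvature function with respect to the unit
  normal \<open>\<nu>\<close> is \<open>H\<close>; here \<open>\<nu> d x\<close> are the components in \<open>d\<close> of the normal at \<open>F x\<close>.
\<close>

definition has_mean_curvature ::
    "('a, 'e::real_normed_vector) chart set \<Rightarrow> ('b, 'f::real_normed_vector) chart set \<Rightarrow>
     ('b, 'f) metric \<Rightarrow> ('a \<Rightarrow> 'b) \<Rightarrow> (('b, 'f) chart \<Rightarrow> 'a \<Rightarrow> 'f) \<Rightarrow> ('a \<Rightarrow> real) \<Rightarrow> bool" where
  "has_mean_curvature A B k F \<nu> H \<longleftrightarrow>
     dim (UNIV :: 'e set) + 1 = dim (UNIV :: 'f set) \<and> nondegenerate_immersion A B k F \<and>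
     (\<forall>c\<in>A. \<forall>d\<in>B. \<forall>x\<in>fst c \<inter> F -` fst d.
        let \<epsilon> = k d (F x) (\<nu> d x) (\<nu> d x) in
          \<epsilon> \<in> {1, -1} \<and> (\<forall>v. k d (F x) (\<nu> d x) (dmap c d F x v) = 0) \<and>
          mean_curvature_vector k c d F x = (\<epsilon> * H x) *\<^sub>R \<nu> d x)"

section \<open>Lie groups and decomposable manifolds\<close>

definition lie_group :: "('s, 'l::real_normed_vector) chart set \<Rightarrow> ('s, 'z) monoid_scheme \<Rightarrow> bool" where
  "lie_group S G \<longleftrightarrow> group G \<and> smooth_manifold S \<and> mcarrier S = carrier G \<and>
     smooth_map (prod_atlas S S) S (\<lambda>(a, b). a \<otimes>\<^bsub>G\<^esub> b) \<and> smooth_map S S (\<lambda>a. inv\<^bsub>G\<^esub> a)"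

definition proper_smooth_action :: "('s, 'l::real_normed_vector) chart set \<Rightarrow> ('s, 'z) monoid_scheme \<Rightarrow>
    ('a, 'e::real_normed_vector) chart set \<Rightarrow> ('s \<Rightarrow> 'a \<Rightarrow> 'a) \<Rightarrow> bool" where
  "proper_smooth_action S G A act \<longleftrightarrow> group_action G (mcarrier A) act \<and>
     smooth_map (prod_atlas S A) A (\<lambda>(\<sigma>, x). act \<sigma> x) \<and>
     proper_map (prod_topology (mtop S) (mtop A)) (prod_topology (mtop A) (mtop A))
       (\<lambda>(\<sigma>, x). (act \<sigma> x, x))"

definition isometry :: "('a, 'e::real_normed_vector) chart set \<Rightarrow> ('a, 'e) metric \<Rightarrow> ('a \<Rightarrow> 'a) \<Rightarrow> bool" where
  "isometry A g F \<longleftrightarrow> diffeomorphism A A F \<and>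
     (\<forall>c\<in>A. \<forall>d\<in>A. \<forall>x\<in>fst c \<inter> F -` fst d. \<forall>v w. pullback_at g c d F x v w = g c x v w)"

text \<open>
  Tangent space at \<open>x\<close> of the orbit of \<open>x\<close>, in the chart \<open>d\<close> about \<open>x\<close>: the image of the Lie
  algebra, in the chart \<open>a\<close> about the neutral element.
\<close>

definition orbit_tangent :: "('s, 'l::real_normed_vector) chart \<Rightarrow> ('s, 'z) monoid_scheme \<Rightarrow>
    ('a, 'e::real_normed_vector) chart \<Rightarrow> ('s \<Rightarrow> 'a \<Rightarrow> 'a) \<Rightarrow> 'a \<Rightarrow> 'e set" where
  "orbit_tangent a G d act x = range (dmap a d (\<lambda>\<sigma>. act \<sigma> x) \<one>\<^bsub>G\<^esub>)"

text \<open>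
  The manifold structure of a homogeneous space is the unique one making the projection of the
  group a submersion.
\<close>

definition homogeneous_space :: "('s, 'l::real_normed_vector) chart set \<Rightarrow> ('s, 'z) monoid_scheme \<Rightarrow>
    's set \<Rightarrow> ('s set, 'n::real_normed_vector) chart set \<Rightarrow> bool" where
  "homogeneous_space S G K Q \<longleftrightarrow>
     smooth_manifold Q \<and> mcarrier Q = lcosets\<^bsub>G\<^esub> K \<and> smooth_map S Q (\<lambda>\<sigma>. \<sigma> <#\<^bsub>G\<^esub> K) \<and>
     (\<forall>a\<in>S. \<forall>q\<in>Q. \<forall>\<sigma>\<in>fst a. \<sigma> <#\<^bsub>G\<^esub> K \<in> fst q \<longrightarrow> surj (dmap a q (\<lambda>\<sigma>. \<sigma> <#\<^bsub>G\<^esub> K) \<sigma>))"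

text \<open>
  \<open>(A, g)\<close> is decomposable by the Lie group \<open>(S, G)\<close> acting by \<open>act\<close>, with submersion \<open>\<pi>\<close>
  onto \<open>(I, \<epsilon>\<^sub>0 ds\<^sup>2)\<close> and associated function \<open>h\<close>. The last four parameters are the point
  whose stabilizer is used, the curve orthogonal to the orbits, the homogeneous space and the
  diffeomorphism; the fibre over \<open>s\<close> is parametrized by \<open>\<lambda>C. \<phi> (s, C)\<close>.
\<close>

locale decomposable =
  fixes A :: "('a, 'e::real_normed_vector) chart set"
    and g :: "('a, 'e) metric"
    and S :: "('s, 'l::real_normed_vector) chart set"
    and G :: "('s, 'z) monoid_scheme"
    and act :: "'s \<Rightarrow> 'a \<Rightarrow> 'a"
    and I :: "real set"
    and \<pi> :: "'a \<Rightarrow> real"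
    and \<epsilon>\<^sub>0 :: real
    and h :: "real \<Rightarrow> real"
    and x\<^sub>0 :: 'a
    and \<beta> :: "real \<Rightarrow> 'a"
    and Q :: "('s set, 'n::real_normed_vector) chart set"
    and \<phi> :: "real \<times> 's set \<Rightarrow> 'a"
  assumes manifold: "pseudo_riemannian_manifold A g"
    and lie_group: "lie_group S G"
    and action: "proper_smooth_action S G A act"
    and isometric: "\<And>\<sigma>. \<sigma> \<in> carrier G \<Longrightarrow> isometry A g (act \<sigma>)"
    and codim_one: "\<And>a d x. a \<in> S \<Longrightarrow> \<one>\<^bsub>G\<^esub> \<in> fst a \<Longrightarrow> d \<in> A \<Longrightarrow> x \<in> fst d \<Longrightarrow>
          dim (orbit_tangent a G d act x) + 1 = dim (UNIV :: 'e set)"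
    and interval: "open I" "is_interval I" "I \<noteq> {}"
    and orbit_space: "quotient_map (mtop A) (top_of_set I) \<pi>"
    and fibres: "\<And>x. x \<in> mcarrier A \<Longrightarrow> {y \<in> mcarrier A. \<pi> y = \<pi> x} = orbit G act x"
    and sign: "\<epsilon>\<^sub>0 \<in> {1, -1}"
    and grad_sign: "\<And>c x. c \<in> A \<Longrightarrow> x \<in> fst c \<Longrightarrow> g c x (grad g c \<pi> x) (grad g c \<pi> x) = \<epsilon>\<^sub>0"
    and submersion: "pseudo_riemannian_submersion A g (interval_atlas I) (line_metric \<epsilon>\<^sub>0) \<pi>"
    and base_point: "x\<^sub>0 \<in> mcarrier A"
    and quotient: "homogeneous_space S G (stabilizer G act x\<^sub>0) Q"
    and curve_smooth: "smooth_map (interval_atlas I) A \<beta>"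
    and curve_unit: "\<And>s d. s \<in> I \<Longrightarrow> d \<in> A \<Longrightarrow> \<beta> s \<in> fst d \<Longrightarrow>
          \<bar>g d (\<beta> s) (vector_derivative (snd d \<circ> \<beta>) (at s)) (vector_derivative (snd d \<circ> \<beta>) (at s))\<bar> = 1"
    and curve_orthogonal: "\<And>s a d v. s \<in> I \<Longrightarrow> a \<in> S \<Longrightarrow> \<one>\<^bsub>G\<^esub> \<in> fst a \<Longrightarrow> d \<in> A \<Longrightarrow> \<beta> s \<in> fst d \<Longrightarrow>
          v \<in> orbit_tangent a G d act (\<beta> s) \<Longrightarrow>
          g d (\<beta> s) (vector_derivative (snd d \<circ> \<beta>) (at s)) v = 0"
    and phi_eq: "\<And>s \<sigma>. s \<in> I \<Longrightarrow> \<sigma> \<in> carrier G \<Longrightarrow>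
          \<phi> (s, \<sigma> <#\<^bsub>G\<^esub> stabilizer G act x\<^sub>0) = act \<sigma> (\<beta> s)"
    and phi_diffeo: "diffeomorphism (prod_atlas (interval_atlas I) Q) A \<phi>"
    and pi_phi: "\<And>s C. s \<in> I \<Longrightarrow> C \<in> mcarrier Q \<Longrightarrow> \<pi> (\<phi> (s, C)) = s"
    and h_smooth: "smooth_on I h"
    and fibre_mean_curvature: "\<And>s. s \<in> I \<Longrightarrow>
          has_mean_curvature Q A g (\<lambda>C. \<phi> (s, C)) (\<lambda>d C. - grad g d \<pi> (\<phi> (s, C))) (\<lambda>C. h s)"

section \<open>Translating solitons\<close>

definition dt_field :: "('a \<times> real, 'f::real_normed_vector) chart \<Rightarrow> 'a \<times> real \<Rightarrow> 'f" where
  "dt_field d p = vector_derivative (\<lambda>t. snd d (fst p, t)) (at (snd p))"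

definition translating_soliton ::
    "('b, 'f::real_normed_vector) chart set \<Rightarrow> ('a, 'e::real_normed_vector) chart set \<Rightarrow>
     ('a, 'e) metric \<Rightarrow> real \<Rightarrow> ('b \<Rightarrow> 'a \<times> real) \<Rightarrow> bool" where
  "translating_soliton N A g e F \<longleftrightarrow>
     nondegenerate_immersion N (times_line A) (times_line_metric A g e) F \<and>
     (\<forall>c\<in>N. \<forall>d\<in>times_line A. \<forall>x\<in>fst c \<inter> F -` fst d.
        mean_curvature_vector (times_line_metric A g e) c d F x =
        normal_part (times_line_metric A g e d (F x)) (range (dmap c d F x)) (dt_field d (F x)))"

definition invariant_graph :: "('s, 'z) monoid_scheme \<Rightarrow> ('s \<Rightarrow> 'a \<Rightarrow> 'a) \<Rightarrow> 'a set \<Rightarrow>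
    ('a \<Rightarrow> 'a \<times> real) \<Rightarrow> bool" where
  "invariant_graph G act M F \<longleftrightarrow>
     (\<forall>\<sigma>\<in>carrier G. (\<lambda>(x, t). (act \<sigma> x, t)) ` (F ` M) = F ` M)"

end

theory Submission
  imports Defs
begin

text \<open>
  The graph of \<open>u = f \<circ> \<pi>\<close> is the zero set of \<open>R (x, t) = u x - t\<close>, and the fibres are the level sets
  of \<open>\<pi>\<close>. Both are treated by the same observation. Let \<open>F\<close> be an immersion into a level set of a
  function \<open>R\<close> whose gradient \<open>N\<close> has square \<open>b \<noteq> 0\<close>. Differentiating \<open>R \<circ> F = const\<close> twice
  shows that the second fundamental form is \<open>- (1 / b) Hess R(dF, dF) N\<close>, so the mean curvature vector
  is \<open>- (tr Hess R / b) N\<close>, with the trace over the level set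
  (\<open>level_set_immersion.mean_curvature_vector_eq\<close>).

  For a fibre this means that \<open>h\<close> is the trace of \<open>Hess \<pi>\<close> along the fibre (\<open>fibre_geometry\<close>).
  For the graph, the normal part of \<open>\<partial>\<^sub>t\<close> is \<open>- (1 / b) N\<close>, so the soliton equation says that the
  trace of \<open>Hess u\<close> with respect to the induced metric \<open>g + \<epsilon>' du\<^sup>2\<close> equals one
  (\<open>graph_soliton_at\<close>).

  To evaluate this trace (\<open>graph_metric_hessian_trace\<close>), write \<open>Hess u = f'' d\<pi>\<^sup>2 + f' Hess \<pi>\<close> and split
  each tangent space into the fibre direction and the gradient of \<open>\<pi>\<close>. Along the fibre the induced
  metric is \<open>g\<close> and the trace is \<open>f' h\<close>. In the gradient direction the induced metric has the value
  \<open>\<epsilon>\<^sub>0 + \<epsilon>' f'\<^sup>2\<close> and \<open>Hess \<pi>\<close> vanishes, because the gradient has constant square \<open>\<epsilon>\<^sub>0\<close>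
  (\<open>metric_chart.hess_grad_grad\<close>); the contribution is \<open>f'' / (\<epsilon>\<^sub>0 + \<epsilon>' f'\<^sup>2)\<close>. The sum is one exactly
  when \<open>f\<close> satisfies the differential equation. Invariance under the group is automatic, since the
  orbits are the fibres of \<open>\<pi>\<close>.
\<close>

section \<open>Finite-dimensional normed spaces\<close>

text \<open>
  The model spaces carry a norm but neither an inner product nor a distinguished basis. Finite
  dimension is therefore expressed by an explicit basis. The continuity of its coordinates is what
  the Leibniz rule for families of linear maps rests on.
\<close>

definition finite_basis :: "'e::real_vector set \<Rightarrow> bool" where
  "finite_basis E \<longleftrightarrow> finite E \<and> independent E \<and> span E = UNIV"

lemma finite_basisD:
  assumes "finite_basis E"
  shows "finite E" "independent E" "span E = UNIV"
  using assms by (auto simp: finite_basis_def)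

lemma finite_basis_exists:
  fixes B :: "'e::real_vector set"
  assumes "finite B" "span B = UNIV"
  obtains E :: "'e set" where "finite_basis E"
proof -
  obtain E where E: "E \<subseteq> B" "independent E" "B \<subseteq> span E"
    using real_vector.maximal_independent_subset by blast
  have "span E = UNIV"
    using E(3) assms(2) real_vector.span_minimal[OF E(3)] by auto
  then show ?thesis
    using that[of E] E finite_subset[OF E(1) assms(1)] by (simp add: finite_basis_def)
qed

lemma sum_representation_finite_basis:
  assumes "finite_basis E"
  shows "(\<Sum>b\<in>E. representation E y b *\<^sub>R b) = y"
  using finite_basisD[OF assms] by (intro real_vector.sum_representation_eq) auto

lemma linear_eq_on_finite_basis:
  assumes "finite_basis E" "linear f" "linear g" "\<And>b. b \<in> E \<Longrightarrow> f b = g b"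
  shows "f = g"
proof
  fix y
  have "y \<in> span E" using finite_basisD(3)[OF assms(1)] by simp
  then show "f y = g y" by (rule linear_eq_on[OF assms(2,3)]) (rule assms(4))
qed

lemma independent_card_eq_dim_spans:
  fixes E J :: "'e::real_vector set"
  assumes "finite_basis E" "independent J" "card J = dim (UNIV :: 'e set)"
  shows "span J = UNIV"
proof -
  obtain K where K: "J \<subseteq> K" "independent K" "UNIV \<subseteq> span K"
    using real_vector.maximal_independent_subset_extend[OF subset_UNIV assms(2)] by metis
  have "finite K"
    by (rule conjunct1[OF real_vector.independent_span_bound[of E]])
       (simp_all add: K finite_basisD[OF assms(1)])
  moreover have "card K = card J"
    unfolding assms(3) using K by (intro real_vector.basis_card_eq_dim) auto
  ultimately have "J = K"
    using K(1) by (simp add: card_subset_eq)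
  then show ?thesis using K by auto
qed

lemma card_finite_basis:
  fixes E :: "'e::real_vector set"
  assumes "finite_basis E"
  shows "card E = dim (UNIV :: 'e set)"
  using real_vector.basis_card_eq_dim[of E UNIV] finite_basisD[OF assms] by auto

lemma linear_inj_imp_surj_finite_basis:
  fixes T :: "'e::real_vector \<Rightarrow> 'e"
  assumes "finite_basis (E :: 'e set)" "linear T" "inj T"
  shows "surj T"
proof -
  have inj: "inj_on T V" for V
    using inj_on_subset[OF assms(3)] by simp
  have ind: "independent (T ` E)"
    by (rule linear_independent_injective_image[OF assms(2) finite_basisD(2)[OF assms(1)] inj])
  have "card (T ` E) = dim (UNIV :: 'e set)"
    by (simp add: card_image[OF inj] card_finite_basis[OF assms(1)])
  then have "span (T ` E) = UNIV"
    using independent_card_eq_dim_spans[OF assms(1) ind] by blast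
  then show ?thesis
    unfolding linear_span_image[OF assms(2)] finite_basisD(3)[OF assms(1)] .
qed

text \<open>
  Counting dimensions: the image of a basis together with \<open>N\<close> is independent and as large as a
  basis. It turns the codimension one of the fibres into the orthogonal decomposition of a tangent
  space into the directions of the fibre and the gradient.
\<close>

lemma hyperplane_plus_line:
  fixes L :: "'n::real_vector \<Rightarrow> 'e::real_vector"
  assumes En: "finite_basis (En :: 'n set)" and E: "finite_basis (E :: 'e set)"
    and L: "linear L" "inj L" and N: "N \<notin> range L"
    and dim: "dim (UNIV :: 'n set) + 1 = dim (UNIV :: 'e set)"
  shows "\<exists>v s. y = L v + s *\<^sub>R N"
proof -
  have inj: "inj_on L V" for V
    using inj_on_subset[OF L(2)] by simp
  have ind: "independent (L ` En)"
    by (rule linear_independent_injective_image[OF L(1) finite_basisD(2)[OF En] inj])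
  have sp: "span (L ` En) = range L"
    unfolding linear_span_image[OF L(1)] finite_basisD(3)[OF En] ..
  have ind': "independent (insert N (L ` En))"
    by (rule real_vector.independent_insertI) (use ind N sp in auto)
  have "N \<notin> L ` En" using N by blast
  then have "card (insert N (L ` En)) = dim (UNIV :: 'e set)"
    using card_image[OF inj, of En] card_finite_basis[OF En] finite_basisD(1)[OF En] dim by simp
  then have "span (insert N (L ` En)) = UNIV"
    using independent_card_eq_dim_spans[OF E ind'] by blast
  then have "y \<in> {x. \<exists>k. x - k *\<^sub>R N \<in> range L}"
    unfolding real_vector.span_insert sp by simp
  then obtain k where "y - k *\<^sub>R N \<in> range L"
    by blast
  then obtain v where "y - k *\<^sub>R N = L v" by auto
  then have "y = L v + k *\<^sub>R N" by (simp add: algebra_simps)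
  then show ?thesis by blast
qed

text \<open>
  On the compact set of coordinate vectors with coordinate sum one in absolute value the norm of
  the represented vector has a positive minimum; by homogeneity this bounds all coordinates.
\<close>

lemma representation_bounded:
  fixes E :: "'e::real_normed_vector set"
  assumes E: "finite_basis E"
  shows "\<exists>C>0. \<forall>y b. \<bar>representation E y b\<bar> \<le> C * norm y"
proof -
  note fin = finite_basisD(1)[OF E]
  define S where "S = (\<lambda>b::'e. if b \<in> E then {-1..1::real} else {0})"
  define K where "K = PiE UNIV S \<inter> {c. (\<Sum>b\<in>E. \<bar>c b\<bar>) = 1}"
  define F where "F c = norm (\<Sum>b\<in>E. c b *\<^sub>R b)" for c :: "'e \<Rightarrow> real"
  have "compactin (product_topology (\<lambda>_. euclidean) UNIV) (PiE UNIV S)"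
    by (simp add: compactin_PiE S_def)
  then have "compact (PiE UNIV S)"
    by (simp add: euclidean_product_topology)
  moreover have "closed {c. (\<Sum>b\<in>E. \<bar>c b\<bar>) = (1::real)}"
    by (intro closed_Collect_eq continuous_intros continuous_on_product_coordinates)
  ultimately have cK: "compact K"
    unfolding K_def by (rule compact_Int_closed)
  have cF: "continuous_on K F"
    unfolding F_def
    by (intro continuous_intros continuous_on_subset[OF continuous_on_product_coordinates]) auto
  have Fpos: "F c > 0" if "c \<in> K" for c
  proof (rule ccontr)
    assume "\<not> F c > 0"
    then have "(\<Sum>b\<in>E. c b *\<^sub>R b) = 0" by (simp add: F_def)
    then have "c b = 0" if "b \<in> E" for b
      using real_vector.independentD[OF finite_basisD(2)[OF E] fin order_refl] that by blast
    then show False using \<open>c \<in> K\<close> by (simp add: K_def)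
  qed
  obtain m where m: "m > 0" "\<And>c. c \<in> K \<Longrightarrow> m \<le> F c"
  proof (cases "K = {}")
    case True
    then show ?thesis using that[of 1] by auto
  next
    case False
    then obtain c0 where "c0 \<in> K" "\<forall>c\<in>K. F c0 \<le> F c"
      using continuous_attains_inf[OF cK False cF] by blast
    then show ?thesis using that[of "F c0"] Fpos by auto
  qed
  have "\<bar>representation E y b\<bar> \<le> inverse m * norm y" for y b
  proof -
    define t where "t = (\<Sum>b\<in>E. \<bar>representation E y b\<bar>)"
    have zero: "representation E y b = 0" if "b \<notin> E" for b
      using that real_vector.representation_ne_zero by blast
    have le: "\<bar>representation E y b\<bar> \<le> t" for b
      using member_le_sum[of b E "\<lambda>b. \<bar>representation E y b\<bar>"] fin zero[of b]
      by (cases "b \<in> E") (auto simp: t_def intro: sum_nonneg)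
    have t0: "t \<ge> 0" by (auto simp: t_def intro: sum_nonneg)
    have "t \<le> inverse m * norm y"
    proof (cases "t = 0")
      case True
      then show ?thesis using m by simp
    next
      case False
      with t0 have t: "t > 0" by simp
      define c where "c b = representation E y b / t" for b
      have "\<bar>c b\<bar> \<le> 1" for b using le[of b] t by (simp add: c_def)
      then have "- 1 \<le> c b \<and> c b \<le> 1" for b
        by (simp add: abs_le_iff)
      moreover have "(\<Sum>b\<in>E. \<bar>c b\<bar>) = 1"
        using t by (simp add: c_def t_def abs_divide sum_divide_distrib[symmetric])
      ultimately have "c \<in> K"
        using zero by (auto simp: K_def S_def c_def)
      then have "m \<le> F c" by (rule m)
      also have "F c = norm ((1 / t) *\<^sub>R y)"
        by (subst (2) sum_representation_finite_basis[OF E, symmetric])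
           (simp add: F_def c_def scaleR_sum_right divide_inverse mult.commute)
      also have "\<dots> = norm y / t" using t by simp
      finally show ?thesis using t m by (simp add: field_simps)
    qed
    with le[of b] show ?thesis by linarith
  qed
  then show ?thesis using m by (intro exI[of _ "inverse m"]) simp
qed

lemma linear_finite_basis_expand:
  assumes "finite_basis E" "linear f"
  shows "f y = (\<Sum>b\<in>E. representation E y b *\<^sub>R f b)"
proof -
  have "f y = f (\<Sum>b\<in>E. representation E y b *\<^sub>R b)"
    by (simp add: sum_representation_finite_basis[OF assms(1)])
  also have "\<dots> = (\<Sum>b\<in>E. f (representation E y b *\<^sub>R b))"
    by (rule linear_sum[OF assms(2)])
  also have "\<dots> = (\<Sum>b\<in>E. representation E y b *\<^sub>R f b)"
    by (intro sum.cong refl linear_scale[OF assms(2)])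
  finally show ?thesis .
qed

lemma bounded_linear_representation:
  fixes E :: "'e::real_normed_vector set"
  assumes "finite_basis E"
  shows "bounded_linear (\<lambda>y. representation E y b)"
proof -
  obtain C where C: "\<And>y b. \<bar>representation E y b\<bar> \<le> C * norm y"
    using representation_bounded[OF assms] by auto
  have sp: "y \<in> span E" for y using finite_basisD(3)[OF assms] by simp
  note ind = finite_basisD(2)[OF assms]
  show ?thesis
  proof (rule bounded_linear_intro)
    show "representation E (x + y) b = representation E x b + representation E y b" for x y
      by (rule real_vector.representation_add[OF ind sp sp, THEN fun_cong])
    show "representation E (r *\<^sub>R x) b = r *\<^sub>R representation E x b" for r x
      using real_vector.representation_scale[OF ind sp, THEN fun_cong] by simp
    show "norm (representation E x b) \<le> norm x * C" for x
      using C[of x b] by (simp add: mult.commute)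
  qed
qed

section \<open>Nondegenerate forms and traces\<close>

definition scalar_product :: "('e::real_vector \<Rightarrow> 'e \<Rightarrow> real) \<Rightarrow> bool" where
  "scalar_product b \<longleftrightarrow> bilinear b \<and> (\<forall>v w. b v w = b w v) \<and> nondegenerate_on UNIV b"

lemma scalar_product_linear:
  assumes "scalar_product b"
  shows "linear (b v)" "linear (\<lambda>v. b v w)"
  using assms by (auto simp: scalar_product_def bilinear_def)

lemma scalar_product_sym: "scalar_product b \<Longrightarrow> b v w = b w v"
  by (simp add: scalar_product_def)

lemma scalar_product_eqI:
  assumes b: "scalar_product b" and eq: "\<And>z. b y z = b y' z"
  shows "y = y'"
proof -
  have "b (y - y') z = 0" for z
    using linear_diff[OF scalar_product_linear(2)[OF b]] eq by simp
  moreover have "v = 0" if "\<And>z. b v z = 0" for v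
    using b that unfolding scalar_product_def nondegenerate_on_def by blast
  ultimately have "y - y' = 0"
    by blast
  then show ?thesis by simp
qed

text \<open>
  The map that replaces the coordinates of \<open>y\<close> by its pairings with the basis is injective by
  nondegeneracy, hence surjective. All gradients and Christoffel symbols exist by this lemma.
\<close>

lemma scalar_product_riesz:
  fixes E :: "'e::real_vector set"
  assumes E: "finite_basis E" and b: "scalar_product (b :: 'e \<Rightarrow> 'e \<Rightarrow> real)" and l: "linear l"
  shows "\<exists>!y. \<forall>z. b y z = l z"
proof -
  note lin = scalar_product_linear[OF b]
  define T where "T y = (\<Sum>u\<in>E. b y u *\<^sub>R u)" for y
  have zero: "c u = 0" if "(\<Sum>u\<in>E. c u *\<^sub>R u) = 0" "u \<in> E" for c u
    using real_vector.independentD[OF finite_basisD(2,1)[OF E] order_refl that] .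
  have linT: "linear T"
    by (rule linearI)
       (simp_all add: T_def linear_add[OF lin(2)] linear_scale[OF lin(2)] scaleR_left_distrib
         sum.distrib scaleR_sum_right)
  have "inj T"
  proof (rule linear_injective_0[OF linT, THEN iffD2], intro allI impI)
    fix y assume "T y = 0"
    then have "b y u = b 0 u" if "u \<in> E" for u
      using zero that linear_0[OF lin(2)] by (simp add: T_def)
    then have "b y = b 0"
      by (intro linear_eq_on_finite_basis[OF E lin(1) lin(1)])
    then show "y = 0" by (intro scalar_product_eqI[OF b]) simp
  qed
  then obtain y where y: "T y = (\<Sum>u\<in>E. l u *\<^sub>R u)"
    using linear_inj_imp_surj_finite_basis[OF E linT] by (metis surjD)
  have "(\<Sum>u\<in>E. (b y u - l u) *\<^sub>R u) = 0"
    using y by (simp add: T_def scaleR_left_diff_distrib sum_subtractf)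
  then have "b y u = l u" if "u \<in> E" for u
    using zero that by fastforce
  then have "b y = l"
    by (intro linear_eq_on_finite_basis[OF E lin(1) l])
  then show ?thesis
    using scalar_product_eqI[OF b] by metis
qed

lemma dual_frame_exists:
  fixes E :: "'e::real_vector set"
  assumes E: "finite_basis E" and b: "scalar_product (b :: 'e \<Rightarrow> 'e \<Rightarrow> real)"
  shows "\<exists>d. (\<forall>u\<in>E. \<forall>y. b (d u) y = representation E y u) \<and> (\<forall>y. y = (\<Sum>u\<in>E. b (d u) y *\<^sub>R u))"
proof -
  have "linear (\<lambda>y. representation E y u)" for u
    using real_vector.linear_representation[OF finite_basisD(2,3)[OF E]] by (simp add: linear_def real_scaleR_def[abs_def])
  then have "\<exists>d. \<forall>y. b d y = representation E y u" for u
    using scalar_product_riesz[OF E b] by blast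
  then obtain d where d: "\<And>u y. b (d u) y = representation E y u" by metis
  have "y = (\<Sum>u\<in>E. b (d u) y *\<^sub>R u)" for y
    by (simp add: d sum_representation_finite_basis[OF E])
  with d show ?thesis by blast
qed

text \<open>
  Expanding \<open>e j\<close> in the chosen basis and collecting coefficients replaces one dual pair by the
  other, because \<open>z\<close> is also the sum of the \<open>b z (e j) *\<^sub>R e' j\<close>. An indexed family is used so that
  frames of different spaces can be glued and transported along linear maps.
\<close>

lemma form_trace_frame:
  fixes E0 :: "'e::real_vector set" and B :: "'e \<Rightarrow> 'e \<Rightarrow> 'f::real_vector"
  assumes E0: "finite_basis E0" and b: "scalar_product b" and B: "bilinear B"
    and frame: "\<And>y. y = (\<Sum>j\<in>J. b (e' j) y *\<^sub>R e j)"
  shows "form_trace b B = (\<Sum>j\<in>J. B (e j) (e' j))"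
proof -
  note lin = scalar_product_linear[OF b]
  define E where "E = (SOME E :: 'e set. independent E \<and> span E = UNIV)"
  have E: "independent E" "span E = UNIV"
    using someI[of "\<lambda>E :: 'e set. independent E \<and> span E = UNIV" E0] finite_basisD[OF E0]
    by (auto simp: E_def)
  have "finite E"
    by (rule conjunct1[OF real_vector.independent_span_bound[of E0]])
       (simp_all add: E finite_basisD[OF E0])
  then have fE: "finite_basis E" using E by (simp add: finite_basis_def)
  obtain d where d: "\<And>u y. u \<in> E \<Longrightarrow> b (d u) y = representation E y u"
    and exp1: "\<And>y. y = (\<Sum>u\<in>E. b (d u) y *\<^sub>R u)"
    using dual_frame_exists[OF fE b] by blast
  have dual: "(THE e'. \<forall>u\<in>E. b e' u = (if u = v then 1 else 0)) = d v" if v: "v \<in> E" for v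
  proof (rule the_equality)
    show "\<forall>u\<in>E. b (d v) u = (if u = v then 1 else 0)"
      using d[OF v] by (auto simp: real_vector.representation_basis[OF E(1)])
    fix y assume y: "\<forall>u\<in>E. b y u = (if u = v then 1 else 0)"
    have "b y = b (d v)"
      using y d[OF v] by (intro linear_eq_on_finite_basis[OF fE lin(1) lin(1)])
        (auto simp: real_vector.representation_basis[OF E(1)])
    then show "y = d v" by (intro scalar_product_eqI[OF b]) simp
  qed
  have exp2: "(\<Sum>j\<in>J. b z (e j) *\<^sub>R e' j) = z" for z
  proof (rule scalar_product_eqI[OF b])
    fix w
    have "b (\<Sum>j\<in>J. b z (e j) *\<^sub>R e' j) w = (\<Sum>j\<in>J. b z (e j) * b (e' j) w)"
      by (simp add: linear_sum[OF lin(2)] linear_scale[OF lin(2)])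
    also have "\<dots> = b z (\<Sum>j\<in>J. b (e' j) w *\<^sub>R e j)"
      by (simp add: linear_sum[OF lin(1)] linear_scale[OF lin(1)] mult.commute)
    also have "\<dots> = b z w" using frame[of w] by simp
    finally show "b (\<Sum>j\<in>J. b z (e j) *\<^sub>R e' j) w = b z w" .
  qed
  have linB: "linear (B v)" "linear (\<lambda>v. B v w)" for v w
    using B by (auto simp: bilinear_def)
  have "(\<Sum>j\<in>J. B (e j) (e' j)) = (\<Sum>j\<in>J. B (\<Sum>u\<in>E. b (d u) (e j) *\<^sub>R u) (e' j))"
    using exp1 by simp
  also have "\<dots> = (\<Sum>j\<in>J. \<Sum>u\<in>E. b (d u) (e j) *\<^sub>R B u (e' j))"
    by (simp add: linear_sum[OF linB(2)] linear_scale[OF linB(2)])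
  also have "\<dots> = (\<Sum>u\<in>E. \<Sum>j\<in>J. b (d u) (e j) *\<^sub>R B u (e' j))"
    by (rule sum.swap)
  also have "\<dots> = (\<Sum>u\<in>E. B u (\<Sum>j\<in>J. b (d u) (e j) *\<^sub>R e' j))"
    by (simp add: linear_sum[OF linB(1)] linear_scale[OF linB(1)])
  also have "\<dots> = (\<Sum>u\<in>E. B u (d u))" by (simp add: exp2)
  finally show ?thesis
    unfolding form_trace_def Let_def E_def[symmetric] using dual by simp
qed

lemma form_trace_scaleR: "form_trace b (\<lambda>v w. B v w *\<^sub>R N) = form_trace b B *\<^sub>R N"
  by (simp add: form_trace_def Let_def scaleR_sum_left)

lemma scalar_product_comp:
  assumes b: "scalar_product b" and L: "linear L" "inj L" "surj L"
  shows "scalar_product (\<lambda>v w. b (L v) (L w))"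
proof -
  note lin = scalar_product_linear[OF b]
  have "v = 0" if "\<And>w. b (L v) (L w) = 0" for v
  proof -
    have "b (L v) z = b 0 z" for z
      using that L(3) linear_0[OF lin(2)] by (metis surjD)
    then have "L v = 0" by (rule scalar_product_eqI[OF b])
    then show ?thesis using L linear_injective_0 by blast
  qed
  then show ?thesis
    using scalar_product_sym[OF b]
    by (auto simp: scalar_product_def bilinear_def nondegenerate_on_def
        intro!: linear_compose[OF L(1) lin(1), unfolded o_def] linear_compose[OF L(1) lin(2), unfolded o_def])
qed

lemma form_trace_comp:
  fixes L :: "'n::real_vector \<Rightarrow> 'e::real_vector" and En :: "'n set" and E :: "'e set"
  assumes En: "finite_basis En" and E: "finite_basis E" and b: "scalar_product b"
    and B: "bilinear B" and L: "linear L" "inj L" "surj L"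
  shows "form_trace (\<lambda>v w. b (L v) (L w)) (\<lambda>v w. B (L v) (L w)) = form_trace b B"
proof -
  have bL: "scalar_product (\<lambda>v w. b (L v) (L w))" by (rule scalar_product_comp[OF b L])
  have BL: "bilinear (\<lambda>v w. B (L v) (L w))"
    using B by (auto simp: bilinear_def intro!: linear_compose[OF L(1), unfolded o_def])
  obtain d where d: "\<And>y. y = (\<Sum>u\<in>En. b (L (d u)) (L y) *\<^sub>R u)"
    using dual_frame_exists[OF En bL] by blast
  have "y = (\<Sum>u\<in>En. b (L (d u)) y *\<^sub>R L u)" for y
  proof -
    obtain x where x: "y = L x" using L(3) by (metis surjD)
    have "L x = L (\<Sum>u\<in>En. b (L (d u)) (L x) *\<^sub>R u)" using d by simp
    also have "\<dots> = (\<Sum>u\<in>En. b (L (d u)) (L x) *\<^sub>R L u)"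
      by (simp add: linear_sum[OF L(1)] linear_scale[OF L(1)])
    finally show ?thesis by (simp add: x)
  qed
  then show ?thesis
    using form_trace_frame[OF En bL BL d] form_trace_frame[OF E b B, where J = En and e' = "\<lambda>u. L (d u)" and e = L] by simp
qed

text \<open>
  A frame of the hyperplane together with \<open>N\<close> is a frame of the whole space, and its dual frame
  consists of the dual frame of the hyperplane and \<open>N / b N N\<close>.
\<close>

lemma form_trace_hyperplane_plus_line:
  fixes L :: "'n::real_vector \<Rightarrow> 'e::real_vector" and En :: "'n set" and E :: "'e set"
    and B :: "'e \<Rightarrow> 'e \<Rightarrow> real"
  assumes En: "finite_basis En" and E: "finite_basis E" and b: "scalar_product b"
    and bL: "scalar_product (\<lambda>v w. b (L v) (L w))"
    and B: "bilinear B" and L: "linear L"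
    and N: "\<And>v. b N (L v) = 0" "b N N \<noteq> 0"
    and split: "\<And>y. \<exists>v s. y = L v + s *\<^sub>R N"
  shows "form_trace b B = form_trace (\<lambda>v w. b (L v) (L w)) (\<lambda>v w. B (L v) (L w)) + B N N / b N N"
proof -
  note lin = scalar_product_linear[OF b]
  have BL: "bilinear (\<lambda>v w. B (L v) (L w))"
    using B by (auto simp: bilinear_def intro!: linear_compose[OF L(1), unfolded o_def])
  obtain d where d: "\<And>y. y = (\<Sum>u\<in>En. b (L (d u)) (L y) *\<^sub>R u)"
    using dual_frame_exists[OF En bL] by blast
  define J where "J = insert None (Some ` En)"
  define e where "e j = (case j of None \<Rightarrow> N | Some u \<Rightarrow> L u)" for j
  define e' where "e' j = (case j of None \<Rightarrow> (1 / b N N) *\<^sub>R N | Some u \<Rightarrow> L (d u))" for j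
  have sumJ: "(\<Sum>j\<in>J. h j) = h None + (\<Sum>u\<in>En. h (Some u))" for h :: "'n option \<Rightarrow> 'c::comm_monoid_add"
    using finite_basisD(1)[OF En] by (simp add: J_def sum.reindex)
  have "y = (\<Sum>j\<in>J. b (e' j) y *\<^sub>R e j)" for y
  proof -
    obtain v s where y: "y = L v + s *\<^sub>R N" using split by blast
    have "b N y = s * b N N"
      by (simp add: y linear_add[OF lin(1)] linear_scale[OF lin(1)] N)
    then have s: "b ((1 / b N N) *\<^sub>R N) y = s"
      using N(2) by (simp add: linear_scale[OF lin(2)])
    have "b (L (d u)) y = b (L (d u)) (L v)" for u
      using N(1) scalar_product_sym[OF b, of "L (d u)" N]
      by (simp add: y linear_add[OF lin(1)] linear_scale[OF lin(1)])
    then have "(\<Sum>u\<in>En. b (L (d u)) y *\<^sub>R L u) = L (\<Sum>u\<in>En. b (L (d u)) (L v) *\<^sub>R u)"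
      by (simp add: linear_sum[OF L(1)] linear_scale[OF L(1)])
    also have "\<dots> = L v" using d by simp
    finally show ?thesis using s by (simp add: sumJ e_def e'_def y)
  qed
  then have "form_trace b B = (\<Sum>j\<in>J. B (e j) (e' j))"
    by (rule form_trace_frame[OF E b B])
  also have "\<dots> = B N N / b N N + (\<Sum>u\<in>En. B (L u) (L (d u)))"
    using B by (simp add: sumJ e_def e'_def bilinear_rmul)
  also have "(\<Sum>u\<in>En. B (L u) (L (d u))) = form_trace (\<lambda>v w. b (L v) (L w)) (\<lambda>v w. B (L v) (L w))"
    using form_trace_frame[OF En bL BL d] by simp
  finally show ?thesis by simp
qed

section \<open>Second derivatives in finite dimension\<close>

definition second_deriv ::
    "('a::real_normed_vector \<Rightarrow> 'b::real_normed_vector) \<Rightarrow> 'a \<Rightarrow> 'a \<Rightarrow> 'a \<Rightarrow> 'b" where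
  "second_deriv f x v w = frechet_derivative (\<lambda>p. frechet_derivative f (at p) w) (at x) v"

definition twice_differentiable_on ::
    "'a::real_normed_vector set \<Rightarrow> ('a \<Rightarrow> 'b::real_normed_vector) \<Rightarrow> bool" where
  "twice_differentiable_on X f \<longleftrightarrow> open X \<and>
     (\<forall>x\<in>X. f differentiable (at x) \<and> (\<forall>w. (\<lambda>p. frechet_derivative f (at p) w) differentiable (at x)))"

lemma twice_differentiable_onD:
  assumes "twice_differentiable_on X f"
  shows "open X" "x \<in> X \<Longrightarrow> f differentiable (at x)"
    "x \<in> X \<Longrightarrow> (\<lambda>p. frechet_derivative f (at p) w) differentiable (at x)"
  using assms by (auto simp: twice_differentiable_on_def)

lemma smooth_on_imp_twice_differentiable_on:
  assumes "open X" "smooth_on X f"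
  shows "twice_differentiable_on X f"
proof -
  have "Ck_on (Suc (Suc 0)) X f" using assms(2) by (simp add: smooth_on_def)
  then show ?thesis using assms(1) by (simp add: twice_differentiable_on_def)
qed

lemma smooth_on_imp_differentiable:
  assumes "smooth_on X f" "x \<in> X"
  shows "f differentiable (at x)"
proof -
  have "Ck_on (Suc 0) X f" using assms(1) by (simp add: smooth_on_def)
  then show ?thesis using assms(2) by simp
qed

lemma frechet_derivative_eqI: "(f has_derivative f') (at x) \<Longrightarrow> frechet_derivative f (at x) = f'"
  by (simp add: frechet_derivative_at[symmetric])

lemma has_derivative_frechet: "f differentiable (at x) \<Longrightarrow> (f has_derivative frechet_derivative f (at x)) (at x)"
  by (simp add: frechet_derivative_works)

lemma differentiable_transform_within_open:
  assumes "f differentiable (at x)" "open X" "x \<in> X" "\<And>y. y \<in> X \<Longrightarrow> f y = g y"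
  shows "g differentiable (at x)"
  using has_derivative_transform_within_open[OF has_derivative_frechet[OF assms(1)] assms(2,3), of g] assms(4)
  by (auto simp: differentiable_def)

lemma frechet_derivative_cong_open:
  assumes X: "open X" "x \<in> X" and eq: "\<And>y. y \<in> X \<Longrightarrow> f y = g y"
  shows "frechet_derivative f (at x) = frechet_derivative g (at x)"
proof -
  have "(f has_derivative D) (at x) \<longleftrightarrow> (g has_derivative D) (at x)" for D
    using has_derivative_transform_within_open[of f D x UNIV X g]
      has_derivative_transform_within_open[of g D x UNIV X f] X eq by auto
  then show ?thesis by (simp add: frechet_derivative_def)
qed

lemma frechet_derivative_chain:
  assumes "f differentiable (at x)" "g differentiable (at (f x))"
  shows "frechet_derivative (g \<circ> f) (at x) v =
    frechet_derivative g (at (f x)) (frechet_derivative f (at x) v)"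
  using frechet_derivative_eqI[OF diff_chain_at[OF has_derivative_frechet[OF assms(1)]
      has_derivative_frechet[OF assms(2)]]] by simp

lemma second_deriv_cong_open:
  assumes X: "open X" "x \<in> X" and eq: "\<And>y. y \<in> X \<Longrightarrow> f y = g y"
  shows "second_deriv f x = second_deriv g x"
proof (intro ext)
  fix v w
  have "frechet_derivative f (at p) w = frechet_derivative g (at p) w" if "p \<in> X" for p
    using frechet_derivative_cong_open[OF X(1) that eq] by simp
  then show "second_deriv f x v w = second_deriv g x v w"
    unfolding second_deriv_def by (intro fun_cong[OF frechet_derivative_cong_open[OF X]])
qed

lemma twice_differentiable_on_cong:
  assumes f: "twice_differentiable_on X f" and eq: "\<And>y. y \<in> X \<Longrightarrow> f y = g y"
  shows "twice_differentiable_on X g"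
proof -
  note D = twice_differentiable_onD[OF f]
  have "frechet_derivative f (at p) w = frechet_derivative g (at p) w" if "p \<in> X" for p w
    using frechet_derivative_cong_open[OF D(1) that eq] by simp
  then show ?thesis
    unfolding twice_differentiable_on_def
    using D(1) differentiable_transform_within_open[OF D(2) D(1) _ eq]
      differentiable_transform_within_open[OF D(3) D(1)] by simp
qed

lemma linear_frechet_derivative_family:
  assumes X: "open X" "x \<in> X" and lin: "\<And>q. q \<in> X \<Longrightarrow> linear (\<Lambda> q)"
    and diff: "\<And>w. (\<lambda>q. \<Lambda> q w) differentiable (at x)"
  shows "linear (\<lambda>w. frechet_derivative (\<lambda>q. \<Lambda> q w) (at x) v)"
proof (rule linearI)
  note D = has_derivative_frechet[OF diff]
  show "frechet_derivative (\<lambda>q. \<Lambda> q (a + b)) (at x) v =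
      frechet_derivative (\<lambda>q. \<Lambda> q a) (at x) v + frechet_derivative (\<lambda>q. \<Lambda> q b) (at x) v" for a b
  proof -
    have "frechet_derivative (\<lambda>q. \<Lambda> q (a + b)) (at x) = frechet_derivative (\<lambda>q. \<Lambda> q a + \<Lambda> q b) (at x)"
      by (rule frechet_derivative_cong_open[OF X]) (simp add: linear_add[OF lin])
    then show ?thesis
      using frechet_derivative_eqI[OF has_derivative_add[OF D[of a] D[of b]]] by simp
  qed
  show "frechet_derivative (\<lambda>q. \<Lambda> q (r *\<^sub>R a)) (at x) v = r *\<^sub>R frechet_derivative (\<lambda>q. \<Lambda> q a) (at x) v" for r a
  proof -
    have "frechet_derivative (\<lambda>q. \<Lambda> q (r *\<^sub>R a)) (at x) = frechet_derivative (\<lambda>q. r *\<^sub>R \<Lambda> q a) (at x)"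
      by (rule frechet_derivative_cong_open[OF X]) (simp add: linear_scale[OF lin])
    then show ?thesis
      using frechet_derivative_eqI[OF has_derivative_scaleR_right[OF D[of a]]] by simp
  qed
qed

lemma bilinear_second_deriv:
  assumes "twice_differentiable_on X f" "x \<in> X"
  shows "bilinear (second_deriv f x)"
  unfolding bilinear_def second_deriv_def
  using assms by (auto simp: twice_differentiable_on_def
      intro!: linear_frechet_derivative linear_frechet_derivative_family[of X])

text \<open>
  The Leibniz rule for evaluating a family of linear maps on a vector field. In finite dimension
  differentiability at each fixed vector suffices, by expanding the vector field in a basis.
\<close>

lemma has_derivative_linear_family:
  fixes \<Lambda> :: "'a::real_normed_vector \<Rightarrow> 'e::real_normed_vector \<Rightarrow> 'g::real_normed_vector"
  assumes E: "finite_basis (E :: 'e set)" and X: "open X" "x \<in> X"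
    and lin: "\<And>q. q \<in> X \<Longrightarrow> linear (\<Lambda> q)"
    and diff: "\<And>w. (\<lambda>q. \<Lambda> q w) differentiable (at x)"
    and Y: "(Y has_derivative Y') (at x)"
  shows "((\<lambda>q. \<Lambda> q (Y q)) has_derivative
    (\<lambda>v. frechet_derivative (\<lambda>q. \<Lambda> q (Y x)) (at x) v + \<Lambda> x (Y' v))) (at x)"
proof -
  define D where "D w = frechet_derivative (\<lambda>q. \<Lambda> q w) (at x)" for w
  have D: "((\<lambda>q. \<Lambda> q w) has_derivative D w) (at x)" for w
    unfolding D_def by (rule has_derivative_frechet[OF diff])
  have linD: "linear (\<lambda>w. D w v)" for v
    unfolding D_def by (rule linear_frechet_derivative_family[OF X lin diff])
  have rep: "((\<lambda>q. representation E (Y q) b) has_derivative (\<lambda>v. representation E (Y' v) b)) (at x)" for b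
    by (rule bounded_linear.has_derivative[OF bounded_linear_representation[OF E] Y])
  have "((\<lambda>q. \<Sum>b\<in>E. representation E (Y q) b *\<^sub>R \<Lambda> q b) has_derivative
      (\<lambda>v. \<Sum>b\<in>E. representation E (Y x) b *\<^sub>R D b v + representation E (Y' v) b *\<^sub>R \<Lambda> x b)) (at x)"
    by (intro has_derivative_sum has_derivative_scaleR rep D)
  moreover have "(\<Sum>b\<in>E. representation E (Y x) b *\<^sub>R D b v + representation E (Y' v) b *\<^sub>R \<Lambda> x b)
      = D (Y x) v + \<Lambda> x (Y' v)" for v
    by (simp add: sum.distrib linear_finite_basis_expand[OF E linD, symmetric]
        linear_finite_basis_expand[OF E lin[OF X(2)], symmetric])
  ultimately have "((\<lambda>q. \<Sum>b\<in>E. representation E (Y q) b *\<^sub>R \<Lambda> q b) has_derivative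
      (\<lambda>v. D (Y x) v + \<Lambda> x (Y' v))) (at x)"
    by simp
  then show ?thesis
    unfolding D_def
    by (rule has_derivative_transform_within_open[OF _ X])
       (simp add: linear_finite_basis_expand[OF E lin, symmetric])
qed

text \<open>
  The second-order chain rule: the Leibniz rule for the family \<open>D R\<close> at \<open>\<Psi> q\<close> applied to the
  vector field \<open>D \<Psi> w\<close>.
\<close>

lemma second_deriv_comp:
  fixes \<Psi> :: "'m::real_normed_vector \<Rightarrow> 'f::real_normed_vector" and R :: "'f \<Rightarrow> 'g::real_normed_vector"
  assumes E: "finite_basis (E :: 'f set)"
    and \<Psi>: "twice_differentiable_on X \<Psi>" and R: "twice_differentiable_on T R"
    and sub: "\<And>p. p \<in> X \<Longrightarrow> \<Psi> p \<in> T"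
  shows "twice_differentiable_on X (R \<circ> \<Psi>)"
    and "\<And>p. p \<in> X \<Longrightarrow> second_deriv (R \<circ> \<Psi>) p v w =
      second_deriv R (\<Psi> p) (frechet_derivative \<Psi> (at p) v) (frechet_derivative \<Psi> (at p) w) +
      frechet_derivative R (at (\<Psi> p)) (second_deriv \<Psi> p v w)"
proof -
  note X = twice_differentiable_onD(1)[OF \<Psi>]
  have diff: "(R \<circ> \<Psi>) differentiable (at p)" if "p \<in> X" for p
    using differentiable_chain_at[OF twice_differentiable_onD(2)[OF \<Psi> that] twice_differentiable_onD(2)[OF R sub[OF that]]] .
  have chain: "frechet_derivative (R \<circ> \<Psi>) (at p) w = frechet_derivative R (at (\<Psi> p)) (frechet_derivative \<Psi> (at p) w)"
    if "p \<in> X" for p w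
    using frechet_derivative_chain[OF twice_differentiable_onD(2)[OF \<Psi> that] twice_differentiable_onD(2)[OF R sub[OF that]]] .
  have deriv: "((\<lambda>q. frechet_derivative (R \<circ> \<Psi>) (at q) w) has_derivative
      (\<lambda>v. second_deriv R (\<Psi> p) (frechet_derivative \<Psi> (at p) v) (frechet_derivative \<Psi> (at p) w) +
        frechet_derivative R (at (\<Psi> p)) (second_deriv \<Psi> p v w))) (at p)" if p: "p \<in> X" for p w
  proof -
    let ?\<Lambda> = "\<lambda>q w. frechet_derivative R (at (\<Psi> q)) w"
    have D\<Lambda>: "((\<lambda>q. ?\<Lambda> q w) has_derivative (\<lambda>v. second_deriv R (\<Psi> p) (frechet_derivative \<Psi> (at p) v) w)) (at p)" for w
      using diff_chain_at[OF has_derivative_frechet[OF twice_differentiable_onD(2)[OF \<Psi> p]]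
          has_derivative_frechet[OF twice_differentiable_onD(3)[OF R sub[OF p]]]]
      by (simp add: o_def second_deriv_def)
    have lin: "linear (?\<Lambda> q)" if "q \<in> X" for q
      by (rule linear_frechet_derivative[OF twice_differentiable_onD(2)[OF R sub[OF that]]])
    have dif: "(\<lambda>q. ?\<Lambda> q w) differentiable (at p)" for w
      using D\<Lambda> by (auto simp: differentiable_def)
    have Y: "((\<lambda>q. frechet_derivative \<Psi> (at q) w) has_derivative (\<lambda>v. second_deriv \<Psi> p v w)) (at p)"
      unfolding second_deriv_def
      by (rule has_derivative_frechet[OF twice_differentiable_onD(3)[OF \<Psi> p]])
    have "((\<lambda>q. ?\<Lambda> q (frechet_derivative \<Psi> (at q) w)) has_derivative
      (\<lambda>v. second_deriv R (\<Psi> p) (frechet_derivative \<Psi> (at p) v) (frechet_derivative \<Psi> (at p) w) +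
        frechet_derivative R (at (\<Psi> p)) (second_deriv \<Psi> p v w))) (at p)"
      using has_derivative_linear_family[OF E X p lin dif Y] unfolding frechet_derivative_eqI[OF D\<Lambda>] .
    then show ?thesis
      by (rule has_derivative_transform_within_open[OF _ X p]) (simp add: chain)
  qed
  show "twice_differentiable_on X (R \<circ> \<Psi>)"
    unfolding twice_differentiable_on_def using X diff deriv by (auto simp: differentiable_def)
  show "second_deriv (R \<circ> \<Psi>) p v w =
      second_deriv R (\<Psi> p) (frechet_derivative \<Psi> (at p) v) (frechet_derivative \<Psi> (at p) w) +
      frechet_derivative R (at (\<Psi> p)) (second_deriv \<Psi> p v w)" if "p \<in> X" for p
    using frechet_derivative_eqI[OF deriv[OF that]] by (simp add: second_deriv_def[of "R \<circ> \<Psi>"])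
qed

lemma linear_real_bound:
  fixes l :: "'e::real_normed_vector \<Rightarrow> real"
  assumes E: "finite_basis E" and C: "\<And>y b. \<bar>representation E y b\<bar> \<le> C * norm y" and l: "linear l"
  shows "\<bar>l v\<bar> \<le> C * norm v * (\<Sum>b\<in>E. \<bar>l b\<bar>)"
proof -
  have "\<bar>l v\<bar> = \<bar>\<Sum>b\<in>E. representation E v b * l b\<bar>"
    by (subst linear_finite_basis_expand[OF E l]) simp
  also have "\<dots> \<le> (\<Sum>b\<in>E. \<bar>representation E v b\<bar> * \<bar>l b\<bar>)"
    by (rule order_trans[OF sum_abs]) (simp add: abs_mult)
  also have "\<dots> \<le> (\<Sum>b\<in>E. (C * norm v) * \<bar>l b\<bar>)"
    by (intro sum_mono mult_right_mono C) simp
  finally show ?thesis by (simp add: sum_distrib_left)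
qed

text \<open>
  Let \<open>G p\<close> be the vector dual to \<open>l p\<close> and \<open>w = G x\<close>. Then
  \<open>\<gamma> p w w - 2 * l p w + e = \<gamma> p (G p - w) (G p - w)\<close>, and the right-hand side vanishes to second
  order at \<open>x\<close>: the difference \<open>G p - w\<close> is bounded by the defect \<open>l p - \<gamma> p w\<close>, which is
  differentiable and vanishes at \<open>x\<close>. Hence the left-hand side has derivative zero. The argument
  works with the values of \<open>G\<close> only, so that the field \<open>G\<close> is never differentiated.
\<close>

lemma derivative_along_constant_norm_dual:
  fixes \<gamma> :: "'e::real_normed_vector \<Rightarrow> 'e \<Rightarrow> 'e \<Rightarrow> real"
  assumes E: "finite_basis (E :: 'e set)" and X: "open X" "x \<in> X"
    and \<gamma>: "\<And>p. p \<in> X \<Longrightarrow> scalar_product (\<gamma> p)"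
    and d\<gamma>: "\<And>v w. (\<lambda>p. \<gamma> p v w) differentiable (at x)"
    and l: "\<And>p. p \<in> X \<Longrightarrow> linear (l p)" and dl: "\<And>w. (\<lambda>p. l p w) differentiable (at x)"
    and G: "\<And>p w. p \<in> X \<Longrightarrow> \<gamma> p (G p) w = l p w"
    and e: "\<And>p. p \<in> X \<Longrightarrow> \<gamma> p (G p) (G p) = e"
  shows "frechet_derivative (\<lambda>p. \<gamma> p (G x) (G x)) (at x) v = 2 * frechet_derivative (\<lambda>p. l p (G x)) (at x) v"
proof -
  define w where "w = G x"
  define r where "r p z = l p z - \<gamma> p w z" for p z
  define q where "q p = \<gamma> p w w - 2 * l p w + e" for p
  note fin = finite_basisD(1)[OF E]
  note lin = scalar_product_linear[OF \<gamma>]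
  have linr: "linear (r p)" if "p \<in> X" for p
    unfolding r_def using l[OF that] lin(1)[OF that] by (intro linear_compose_sub)
  have dr: "(\<lambda>p. r p z) differentiable (at x)" for z
    unfolding r_def by (intro differentiable_diff dl d\<gamma>)
  have r0: "r x z = 0" for z
    using G[OF X(2)] by (simp add: r_def w_def)
  have yr: "\<gamma> p (G p - w) z = r p z" if "p \<in> X" for p z
    using G[OF that] by (simp add: r_def linear_diff[OF lin(2)[OF that]])
  have qr: "q p = r p (G p - w)" if p: "p \<in> X" for p
  proof -
    have "r p (G p - w) = l p (G p) - l p w - (\<gamma> p w (G p) - \<gamma> p w w)"
      by (simp add: r_def linear_diff[OF l[OF p]] linear_diff[OF lin(1)[OF p]])
    moreover have "\<gamma> p w (G p) = l p w" using G[OF p] scalar_product_sym[OF \<gamma>[OF p]] by metis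
    moreover have "l p (G p) = e" using G[OF p] e[OF p] by metis
    ultimately show ?thesis by (simp add: q_def)
  qed
  obtain C where C: "C > 0" "\<And>y b. \<bar>representation E y b\<bar> \<le> C * norm y"
    using representation_bounded[OF E] by auto
  note bound = linear_real_bound[OF E C(2)]
  obtain d where d: "\<And>y. y = (\<Sum>u\<in>E. \<gamma> x (d u) y *\<^sub>R u)"
    using dual_frame_exists[OF E \<gamma>[OF X(2)]] by blast
  define \<rho> where "\<rho> p = (\<Sum>b\<in>E. \<bar>r p b\<bar>)" for p
  define \<theta> where "\<theta> p = (\<Sum>u\<in>E. (C * (\<Sum>b\<in>E. \<bar>\<gamma> x b (d u) - \<gamma> p b (d u)\<bar>)) * norm u)" for p
  define K where "K = (\<Sum>u\<in>E. C * norm (d u) * norm u)"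
  have \<rho>0: "\<rho> p \<ge> 0" for p by (simp add: \<rho>_def sum_nonneg)
  have K0: "K \<ge> 0" using C by (simp add: K_def sum_nonneg)
  \<comment> \<open>\<open>\<theta>\<close> measures how far \<open>\<gamma> p\<close> is from \<open>\<gamma> x\<close>; once it is below one half, its term can be absorbed.\<close>
  have ybound: "norm (G p - w) \<le> K * \<rho> p + \<theta> p * norm (G p - w)" if p: "p \<in> X" for p
  proof -
    let ?y = "G p - w"
    have "\<bar>\<gamma> x (d u) ?y\<bar> \<le> C * norm (d u) * \<rho> p + C * (\<Sum>b\<in>E. \<bar>\<gamma> x b (d u) - \<gamma> p b (d u)\<bar>) * norm ?y" for u
    proof -
      have "\<gamma> x (d u) ?y = r p (d u) + (\<gamma> x ?y (d u) - \<gamma> p ?y (d u))"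
        using yr[OF p, of "d u"] scalar_product_sym[OF \<gamma>[OF X(2)]] by simp
      moreover have "\<bar>r p (d u)\<bar> \<le> C * norm (d u) * \<rho> p"
        unfolding \<rho>_def by (rule bound[OF linr[OF p]])
      moreover have "\<bar>\<gamma> x ?y (d u) - \<gamma> p ?y (d u)\<bar> \<le> C * norm ?y * (\<Sum>b\<in>E. \<bar>\<gamma> x b (d u) - \<gamma> p b (d u)\<bar>)"
        by (rule bound) (intro linear_compose_sub lin X(2) p)
      ultimately show ?thesis by (simp add: mult.commute mult.left_commute)
    qed
    then have "norm (\<Sum>u\<in>E. \<gamma> x (d u) ?y *\<^sub>R u) \<le>
        (\<Sum>u\<in>E. (C * norm (d u) * \<rho> p + C * (\<Sum>b\<in>E. \<bar>\<gamma> x b (d u) - \<gamma> p b (d u)\<bar>) * norm ?y) * norm u)"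
      by (intro sum_norm_le) (simp add: mult_right_mono)
    also have "\<dots> = K * \<rho> p + \<theta> p * norm ?y"
      unfolding K_def \<theta>_def sum_distrib_right sum.distrib[symmetric]
      by (intro sum.cong refl) (simp add: algebra_simps)
    finally show ?thesis using d[of ?y] by simp
  qed
  have cont: "((\<lambda>p. \<gamma> p a b) \<longlongrightarrow> \<gamma> x a b) (at x)" for a b
    using differentiable_imp_continuous_within[OF d\<gamma>] by (simp add: continuous_within)
  have "((\<lambda>p. \<theta> p) \<longlongrightarrow> (\<Sum>u\<in>E. (C * (\<Sum>b\<in>E. \<bar>\<gamma> x b (d u) - \<gamma> x b (d u)\<bar>)) * norm u)) (at x)"
    unfolding \<theta>_def by (intro tendsto_intros cont)
  then have "(\<theta> \<longlongrightarrow> 0) (at x)" by simp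
  then have ev\<theta>: "\<forall>\<^sub>F p in at x. \<theta> p < 1 / 2"
    by (rule order_tendstoD) simp
  have evX: "\<forall>\<^sub>F p in at x. p \<in> X"
    using X by (rule eventually_at_in_open')
  define c where "c = 2 * K * C * real (card E)"
  define s where "s p = c * (\<Sum>b\<in>E. (r p b)\<^sup>2)" for p
  have le: "q p \<le> s p" if p: "p \<in> X" and \<theta>: "\<theta> p < 1 / 2" for p
  proof -
    let ?y = "G p - w"
    have "\<theta> p * norm ?y \<le> 1 / 2 * norm ?y" using \<theta> by (intro mult_right_mono) auto
    then have y: "norm ?y \<le> 2 * K * \<rho> p" using ybound[OF p] by simp
    have "q p \<le> C * norm ?y * \<rho> p"
      unfolding qr[OF p] \<rho>_def using bound[OF linr[OF p], of ?y] by linarith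
    also have "\<dots> \<le> C * (2 * K * \<rho> p) * \<rho> p"
      using C y \<rho>0 by (intro mult_right_mono mult_left_mono) auto
    also have "\<dots> = 2 * K * C * (\<rho> p)\<^sup>2" by (simp add: power2_eq_square)
    also have "\<dots> \<le> 2 * K * C * (real (card E) * (\<Sum>b\<in>E. (r p b)\<^sup>2))"
      using sum_squared_le_sum_of_squares[of "\<lambda>b. \<bar>r p b\<bar>" E] C K0
      unfolding \<rho>_def by (intro mult_left_mono) (auto simp: mult.commute)
    finally show ?thesis by (simp add: s_def c_def mult.assoc)
  qed
  \<comment> \<open>\<open>s - q\<close> is differentiable with a local minimum at \<open>x\<close>, and \<open>s\<close> has derivative zero there.\<close>
  have "\<forall>\<^sub>F p in at x. s x - q x \<le> s p - q p"
    using ev\<theta> evX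
  proof eventually_elim
    case (elim p)
    have "s x = 0" "q x = 0" using r0 qr[OF X(2)] by (simp_all add: s_def)
    then show ?case using le elim by simp
  qed
  moreover
  have Dr: "((\<lambda>p. r p b) has_derivative frechet_derivative (\<lambda>p. r p b) (at x)) (at x)" for b
    by (rule has_derivative_frechet[OF dr])
  have "(s has_derivative (\<lambda>h. c * (\<Sum>b\<in>E. r x b * frechet_derivative (\<lambda>p. r p b) (at x) h +
      frechet_derivative (\<lambda>p. r p b) (at x) h * r x b))) (at x)"
    unfolding s_def power2_eq_square
    by (intro has_derivative_mult_right has_derivative_sum has_derivative_mult Dr)
  then have Ds: "(s has_derivative (\<lambda>h. 0)) (at x)" by (simp add: r0)
  let ?D\<gamma> = "frechet_derivative (\<lambda>p. \<gamma> p w w) (at x)" and ?Dl = "frechet_derivative (\<lambda>p. l p w) (at x)"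
  have "(q has_derivative (\<lambda>h. ?D\<gamma> h - 2 * ?Dl h + 0)) (at x)"
    unfolding q_def
    by (intro has_derivative_add has_derivative_diff has_derivative_mult_right has_derivative_const
        has_derivative_frechet d\<gamma> dl)
  with Ds have "((\<lambda>p. s p - q p) has_derivative (\<lambda>h. 0 - (?D\<gamma> h - 2 * ?Dl h + 0))) (at x)"
    by (rule has_derivative_diff)
  ultimately have "(\<lambda>h. 0 - (?D\<gamma> h - 2 * ?Dl h + 0)) = (\<lambda>h. 0)"
    using has_derivative_local_min by blast
  then have "0 - (?D\<gamma> v - 2 * ?Dl v + 0) = 0" by metis
  then show ?thesis by (simp add: w_def)
qed

section \<open>Charts, Hessians and level sets\<close>

definition is_chart :: "('a, 'e::real_normed_vector) chart \<Rightarrow> bool" where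
  "is_chart c \<longleftrightarrow> inj_on (snd c) (fst c) \<and> open (snd c ` fst c)"

lemma smooth_atlas_is_chart: "smooth_atlas A \<Longrightarrow> c \<in> A \<Longrightarrow> is_chart c"
  by (auto simp: smooth_atlas_def is_chart_def)

lemma chart_cinv:
  assumes "is_chart c"
  shows "x \<in> fst c \<Longrightarrow> cinv c (snd c x) = x"
    "p \<in> snd c ` fst c \<Longrightarrow> snd c (cinv c p) = p"
    "p \<in> snd c ` fst c \<Longrightarrow> cinv c p \<in> fst c"
  using assms by (auto simp: is_chart_def cinv_def)

text \<open>The covariant derivative of the differential of \<open>R\<close>, in components of the chart \<open>c\<close>.\<close>

definition hess :: "('a, 'e::real_normed_vector) metric \<Rightarrow> ('a, 'e) chart \<Rightarrow> ('a \<Rightarrow> real) \<Rightarrow> 'a \<Rightarrow>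
    'e \<Rightarrow> 'e \<Rightarrow> real" where
  "hess g c R x v w = second_deriv (R \<circ> cinv c) (snd c x) v w -
     frechet_derivative (R \<circ> cinv c) (at (snd c x)) (christoffel g c x v w)"

text \<open>
  If the tangent space is the hyperplane orthogonal to \<open>N\<close>, the normal part is the orthogonal
  projection to the line of \<open>N\<close>; uniqueness follows from the nondegeneracy of the ambient form.
\<close>

lemma normal_part_hyperplane:
  assumes b: "scalar_product b" and L: "linear L" and N: "\<And>v. b N (L v) = 0" "b N N \<noteq> 0"
    and split: "\<And>y. \<exists>v s. y = L v + s *\<^sub>R N"
  shows "normal_part b (range L) y = (b y N / b N N) *\<^sub>R N"
proof -
  note lin = scalar_product_linear[OF b]
  have coeff: "s = b y N / b N N" if "y = L v + s *\<^sub>R N" for v s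
    using that N scalar_product_sym[OF b, of "L v" N]
    by (simp add: linear_add[OF lin(2)] linear_scale[OF lin(2)])
  obtain v s where y: "y = L v + s *\<^sub>R N" using split by blast
  show ?thesis
    unfolding normal_part_def
  proof (rule the_equality)
    show "(\<forall>t\<in>range L. b ((b y N / b N N) *\<^sub>R N) t = 0) \<and> y - (b y N / b N N) *\<^sub>R N \<in> range L"
      unfolding coeff[OF y, symmetric] using N(1) by (simp add: linear_scale[OF lin(2)] y)
    fix n assume n: "(\<forall>t\<in>range L. b n t = 0) \<and> y - n \<in> range L"
    then obtain v' where v': "y - n = L v'" by auto
    define m where "m = n - (b y N / b N N) *\<^sub>R N"
    have "y - (b y N / b N N) *\<^sub>R N = L v" unfolding coeff[OF y, symmetric] by (simp add: y)
    moreover have "m = (y - (b y N / b N N) *\<^sub>R N) - (y - n)" by (simp add: m_def)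
    ultimately have "m = L (v - v')" unfolding linear_diff[OF L] v' by metis
    then have mN: "b m N = 0" using N(1) scalar_product_sym[OF b] by metis
    have mL: "b m (L z) = 0" for z
      using n N(1) by (simp add: m_def linear_diff[OF lin(2)] linear_scale[OF lin(2)])
    have "b m z = b 0 z" for z
    proof -
      obtain v'' s'' where z: "z = L v'' + s'' *\<^sub>R N" using split by blast
      show ?thesis
        by (simp add: z linear_add[OF lin(1)] linear_scale[OF lin(1)] mN mL linear_0[OF lin(2)])
    qed
    then have "m = 0" by (rule scalar_product_eqI[OF b])
    then show "n = (b y N / b N N) *\<^sub>R N" by (simp add: m_def)
  qed
qed

text \<open>
  If \<open>F\<close> maps into a level set of \<open>R\<close>, then differentiating \<open>R \<circ> F = const\<close> twice expresses the
  pairing of the second derivatives of \<open>F\<close> with \<open>grad R\<close> through second derivatives of \<open>R\<close>; the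
  Christoffel terms turn these into the Hessian. This is used for the fibres, where \<open>R\<close> is the
  submersion, and for the graph of \<open>u\<close>, where \<open>R (x, t) = u x - t\<close>. The vector \<open>N\<close> is the gradient.
\<close>

locale level_set_immersion =
  fixes k :: "('b, 'f::real_normed_vector) metric" and c :: "('a, 'e::real_normed_vector) chart"
    and d :: "('b, 'f) chart" and F :: "'a \<Rightarrow> 'b" and R :: "'b \<Rightarrow> real" and r :: real
    and x :: 'a and N :: 'f and E :: "'f set"
  assumes E: "finite_basis E" and c: "is_chart c" and d: "is_chart d"
    and x: "x \<in> fst c" "F x \<in> fst d"
    and F: "twice_differentiable_on (snd c ` (fst c \<inter> F -` fst d)) (local_rep c d F)"
    and R: "twice_differentiable_on (snd d ` fst d) (R \<circ> cinv d)"
    and level: "\<And>y. y \<in> fst c \<Longrightarrow> F y \<in> fst d \<Longrightarrow> R (F y) = r"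
    and k: "scalar_product (k d (F x))"
    and N: "\<And>w. k d (F x) N w = frechet_derivative (R \<circ> cinv d) (at (snd d (F x))) w"
    and NN: "k d (F x) N N \<noteq> 0"
begin

lemma local_rep_at: "y \<in> fst c \<Longrightarrow> local_rep c d F (snd c y) = snd d (F y)"
  by (simp add: local_rep_def chart_cinv[OF c])

lemma point: "snd c x \<in> snd c ` (fst c \<inter> F -` fst d)"
  using x by auto

lemma image: "p \<in> snd c ` (fst c \<inter> F -` fst d) \<Longrightarrow> local_rep c d F p \<in> snd d ` fst d"
  by (auto simp: local_rep_at)

lemma linear_dmap: "linear (dmap c d F x)"
  unfolding dmap_def by (rule linear_frechet_derivative[OF twice_differentiable_onD(2)[OF F point]])

lemma comp_const: "p \<in> snd c ` (fst c \<inter> F -` fst d) \<Longrightarrow> ((R \<circ> cinv d) \<circ> local_rep c d F) p = r"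
  by (auto simp: local_rep_at chart_cinv[OF d] level)

lemma normal: "k d (F x) N (dmap c d F x v) = 0"
proof -
  have "frechet_derivative ((R \<circ> cinv d) \<circ> local_rep c d F) (at (snd c x)) v =
      frechet_derivative (\<lambda>_. r) (at (snd c x)) v"
    by (intro fun_cong[OF frechet_derivative_cong_open[OF twice_differentiable_onD(1)[OF F] point comp_const]])
  moreover have "frechet_derivative ((R \<circ> cinv d) \<circ> local_rep c d F) (at (snd c x)) v =
      frechet_derivative (R \<circ> cinv d) (at (local_rep c d F (snd c x)))
        (frechet_derivative (local_rep c d F) (at (snd c x)) v)"
    by (rule frechet_derivative_chain[OF twice_differentiable_onD(2)[OF F point]
      twice_differentiable_onD(2)[OF R image[OF point]]])
  ultimately show ?thesis
    unfolding N dmap_def local_rep_at[OF x(1)] by simp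
qed

lemma hess_level_set:
  "k d (F x) N (cov_along k c d F (\<lambda>y. dmap c d F y w) x v) =
    - hess k d R (F x) (dmap c d F x v) (dmap c d F x w)"
proof -
  note open' = twice_differentiable_onD(1)[OF F]
  have "second_deriv ((R \<circ> cinv d) \<circ> local_rep c d F) (snd c x) v w = second_deriv (\<lambda>_. r) (snd c x) v w"
    by (intro fun_cong[OF fun_cong[OF second_deriv_cong_open[OF open' point comp_const]]])
  also have "\<dots> = 0" by (simp add: second_deriv_def)
  finally have "second_deriv (R \<circ> cinv d) (snd d (F x)) (dmap c d F x v) (dmap c d F x w) +
      frechet_derivative (R \<circ> cinv d) (at (snd d (F x))) (second_deriv (local_rep c d F) (snd c x) v w) = 0"
    using second_deriv_comp(2)[OF E F R image point]
    by (simp add: dmap_def local_rep_at[OF x(1)])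
  moreover have "frechet_derivative ((\<lambda>y. dmap c d F y w) \<circ> cinv c) (at (snd c x)) v =
      second_deriv (local_rep c d F) (snd c x) v w"
    unfolding second_deriv_def
    by (rule fun_cong[OF frechet_derivative_cong_open[OF open' point]])
       (auto simp: dmap_def chart_cinv[OF c])
  moreover have "k d (F x) N (a + b) = k d (F x) N a + k d (F x) N b" for a b
    by (rule linear_add[OF scalar_product_linear(1)[OF k]])
  ultimately show ?thesis
    unfolding cov_along_def hess_def by (simp add: N)
qed

context
  assumes split: "\<And>y. \<exists>v s. y = dmap c d F x v + s *\<^sub>R N"
begin

lemma normal_part_eq:
  "normal_part (k d (F x)) (range (dmap c d F x)) y = (k d (F x) y N / k d (F x) N N) *\<^sub>R N"
  by (rule normal_part_hyperplane[OF k linear_dmap normal NN split])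

text \<open>
  By the previous facts the second fundamental form is minus the Hessian of \<open>R\<close> on the level set,
  divided by the square of the gradient \<open>N\<close>, in the direction of \<open>N\<close>; now take the trace.
\<close>

lemma mean_curvature_vector_eq:
  "mean_curvature_vector k c d F x =
    (- form_trace (pullback_at k c d F x) (\<lambda>v w. hess k d R (F x) (dmap c d F x v) (dmap c d F x w)) /
      k d (F x) N N) *\<^sub>R N"
proof -
  have "second_fundamental_form k c d F x =
      (\<lambda>v w. (- hess k d R (F x) (dmap c d F x v) (dmap c d F x w) / k d (F x) N N) *\<^sub>R N)"
    unfolding second_fundamental_form_def normal_part_eq scalar_product_sym[OF k, of "cov_along _ _ _ _ _ _ _"]
      hess_level_set ..
  moreover have "form_trace b (\<lambda>v w. - H v w / q) = - form_trace b H / q"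
    for b H :: "'e \<Rightarrow> 'e \<Rightarrow> real" and q
    unfolding form_trace_def Let_def by (simp only: sum_negf[symmetric] sum_divide_distrib)
  ultimately show ?thesis
    unfolding mean_curvature_vector_def by (simp only: form_trace_scaleR)
qed

end

end

section \<open>The Levi-Civita connection in a chart\<close>

locale metric_chart =
  fixes A :: "('a, 'e::real_normed_vector) chart set" and g :: "('a, 'e) metric"
    and c :: "('a, 'e) chart" and E :: "'e set"
  assumes E: "finite_basis E" and metric: "pseudo_riemannian_metric A g" and c: "c \<in> A" "is_chart c"
begin

lemma open_chart: "open (snd c ` fst c)"
  using c(2) by (simp add: is_chart_def)

lemma scalar_product_metric: "x \<in> fst c \<Longrightarrow> scalar_product (g c x)"
  using metric c(1) unfolding pseudo_riemannian_metric_def scalar_product_def by blast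

lemma scalar_product_metric_cinv: "p \<in> snd c ` fst c \<Longrightarrow> scalar_product (g c (cinv c p))"
  by (rule scalar_product_metric) (rule chart_cinv(3)[OF c(2)])

lemma metric_differentiable: "p \<in> snd c ` fst c \<Longrightarrow> (\<lambda>p. g c (cinv c p) v w) differentiable (at p)"
  using metric c(1) unfolding pseudo_riemannian_metric_def
  by (intro smooth_on_imp_differentiable[of "snd c ` fst c"]) blast+

lemma linear_metric_deriv:
  assumes x: "x \<in> fst c"
  shows "linear (\<lambda>u. metric_deriv g c x u v w)" "linear (\<lambda>v. metric_deriv g c x u v w)"
    "linear (\<lambda>w. metric_deriv g c x u v w)"
proof -
  have p: "snd c x \<in> snd c ` fst c" using x by simp
  note lin = scalar_product_linear[OF scalar_product_metric_cinv]
  show "linear (\<lambda>u. metric_deriv g c x u v w)"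
    unfolding metric_deriv_def by (rule linear_frechet_derivative[OF metric_differentiable[OF p]])
  show "linear (\<lambda>v. metric_deriv g c x u v w)"
    unfolding metric_deriv_def
    by (rule linear_frechet_derivative_family[OF open_chart p, where \<Lambda> = "\<lambda>p v. g c (cinv c p) v w"])
      (simp_all add: lin metric_differentiable[OF p])
  show "linear (\<lambda>w. metric_deriv g c x u v w)"
    unfolding metric_deriv_def
    by (rule linear_frechet_derivative_family[OF open_chart p, where \<Lambda> = "\<lambda>p. g c (cinv c p) v"])
      (simp_all add: lin metric_differentiable[OF p])
qed

lemma linear_koszul:
  assumes x: "x \<in> fst c"
  defines "K \<equiv> \<lambda>v w z. (metric_deriv g c x v w z + metric_deriv g c x w v z - metric_deriv g c x z v w) / 2"
  shows "linear (\<lambda>v. K v w z)" "linear (\<lambda>w. K v w z)" "linear (\<lambda>z. K v w z)"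
proof -
  note lin = linear_metric_deriv[OF x]
  have half: "linear (\<lambda>v. f v / (2 :: real))" if "linear f" for f :: "'e \<Rightarrow> real"
    by (rule linearI) (simp_all add: linear_add[OF that] linear_scale[OF that] add_divide_distrib)
  show "linear (\<lambda>v. K v w z)"
    unfolding K_def by (rule half, rule linear_compose_sub, rule linear_compose_add) (rule lin)+
  show "linear (\<lambda>w. K v w z)"
    unfolding K_def by (rule half, rule linear_compose_sub, rule linear_compose_add) (rule lin)+
  show "linear (\<lambda>z. K v w z)"
    unfolding K_def by (rule half, rule linear_compose_sub, rule linear_compose_add) (rule lin)+
qed

lemma metric_christoffel:
  assumes x: "x \<in> fst c"
  shows "g c x (christoffel g c x v w) z =
    (metric_deriv g c x v w z + metric_deriv g c x w v z - metric_deriv g c x z v w) / 2"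
proof -
  note linear_koszul(3)[OF x, of v w]
  from theI'[OF scalar_product_riesz[OF E scalar_product_metric[OF x] this]]
  show ?thesis by (simp add: christoffel_def)
qed

lemma bilinear_christoffel:
  assumes x: "x \<in> fst c"
  shows "bilinear (christoffel g c x)"
proof -
  note k = scalar_product_metric[OF x]
  have linI: "linear f" if "\<And>z. linear (\<lambda>v. g c x (f v) z)" for f :: "'e \<Rightarrow> 'e"
  proof (rule linearI; rule scalar_product_eqI[OF k])
    note linb = scalar_product_linear(2)[OF k]
    show "g c x (f (a + b)) z = g c x (f a + f b) z" for a b z
      using linear_add[OF that] linear_add[OF linb] by simp
    show "g c x (f (r *\<^sub>R a)) z = g c x (r *\<^sub>R f a) z" for r a z
      using linear_scale[OF that] linear_scale[OF linb] by simp
  qed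
  show ?thesis
    unfolding bilinear_def
    by (intro conjI allI; rule linI; unfold metric_christoffel[OF x]; rule linear_koszul[OF x])
qed

lemma bilinear_hess:
  assumes x: "x \<in> fst c" and R: "twice_differentiable_on (snd c ` fst c) (R \<circ> cinv c)"
  shows "bilinear (hess g c R x)"
proof -
  have p: "snd c x \<in> snd c ` fst c" using x by simp
  have lin: "linear (frechet_derivative (R \<circ> cinv c) (at (snd c x)))"
    by (rule linear_frechet_derivative[OF twice_differentiable_onD(2)[OF R p]])
  have comp: "linear (\<lambda>z. frechet_derivative (R \<circ> cinv c) (at (snd c x)) (f z))" if "linear f" for f :: "'e \<Rightarrow> 'e"
    using linear_compose[OF that lin] by (simp add: o_def)
  have s: "linear (second_deriv (R \<circ> cinv c) (snd c x) v)"
    "linear (\<lambda>v. second_deriv (R \<circ> cinv c) (snd c x) v w)" for v w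
    using bilinear_second_deriv[OF R p] by (simp_all add: bilinear_def)
  have t: "linear (christoffel g c x v)" "linear (\<lambda>v. christoffel g c x v w)" for v w
    using bilinear_christoffel[OF x] by (simp_all add: bilinear_def)
  show ?thesis
    unfolding bilinear_def hess_def
    by (intro conjI allI; rule linear_compose_sub; (rule s | rule comp, rule t))
qed

lemma metric_grad:
  assumes x: "x \<in> fst c" and R: "(R \<circ> cinv c) differentiable (at (snd c x))"
  shows "g c x (grad g c R x) w = frechet_derivative (R \<circ> cinv c) (at (snd c x)) w"
  using theI'[OF scalar_product_riesz[OF E scalar_product_metric[OF x] linear_frechet_derivative[OF R]]]
  by (simp add: grad_def)

text \<open>
  By compatibility of the connection with \<open>g\<close>, the derivative of \<open>g(grad R, grad R)\<close> in the direction
  of \<open>grad R\<close> is twice the value of the Hessian on \<open>grad R\<close>.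
\<close>

lemma hess_grad_grad:
  assumes x: "x \<in> fst c" and R: "twice_differentiable_on (snd c ` fst c) (R \<circ> cinv c)"
    and const: "\<And>y. y \<in> fst c \<Longrightarrow> g c y (grad g c R y) (grad g c R y) = e"
  shows "hess g c R x (grad g c R x) (grad g c R x) = 0"
proof -
  let ?w = "grad g c R x"
  let ?l = "\<lambda>p. frechet_derivative (R \<circ> cinv c) (at p)"
  have p: "snd c x \<in> snd c ` fst c" using x by simp
  note R' = twice_differentiable_onD[OF R]
  have G: "g c (cinv c p) (grad g c R (cinv c p)) w = ?l p w" if "p \<in> snd c ` fst c" for p w
    using metric_grad[OF chart_cinv(3)[OF c(2) that], of R w] R'(2)[OF that] chart_cinv(2)[OF c(2) that]
    by simp
  have "frechet_derivative (\<lambda>p. g c (cinv c p) (grad g c R (cinv c (snd c x))) (grad g c R (cinv c (snd c x))))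
      (at (snd c x)) ?w = 2 * frechet_derivative (\<lambda>p. ?l p (grad g c R (cinv c (snd c x)))) (at (snd c x)) ?w"
    by (rule derivative_along_constant_norm_dual[OF E open_chart p, where G = "\<lambda>p. grad g c R (cinv c p)" and e = e])
       (intro scalar_product_metric_cinv metric_differentiable[OF p] linear_frechet_derivative[OF R'(2)]
          R'(3)[OF p] G const chart_cinv(3)[OF c(2)]; assumption)+
  then have "metric_deriv g c x ?w ?w ?w = 2 * second_deriv (R \<circ> cinv c) (snd c x) ?w ?w"
    by (simp add: metric_deriv_def second_deriv_def chart_cinv(1)[OF c(2) x])
  moreover have "?l (snd c x) (christoffel g c x ?w ?w) = metric_deriv g c x ?w ?w ?w / 2"
    using metric_grad[OF x R'(2)[OF p]] scalar_product_sym[OF scalar_product_metric[OF x]]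
      metric_christoffel[OF x, of ?w ?w ?w] by (metis add_diff_cancel_right')
  ultimately show ?thesis by (simp add: hess_def)
qed

end

section \<open>Coordinate changes\<close>

lemma transition_differentiable:
  assumes "smooth_atlas A" "c \<in> A" "d \<in> A" "x \<in> fst c" "x \<in> fst d"
  shows "local_rep c d id differentiable (at (snd c x))"
  by (rule smooth_on_imp_differentiable[of "snd c ` (fst c \<inter> fst d)"])
     (use assms in \<open>auto simp: smooth_atlas_def\<close>)

lemma dmap_transition_inverse:
  assumes A: "smooth_atlas A" and c: "c \<in> A" and d: "d \<in> A" and x: "x \<in> fst c" "x \<in> fst d"
  shows "dmap d c id x (dmap c d id x v) = v"
proof -
  note ch = smooth_atlas_is_chart[OF A c] smooth_atlas_is_chart[OF A d]
  have op: "open (snd c ` (fst c \<inter> fst d))" using A c d by (auto simp: smooth_atlas_def)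
  have p: "local_rep c d id (snd c x) = snd d x"
    using x by (simp add: local_rep_def chart_cinv[OF ch(1)])
  have "frechet_derivative (local_rep d c id \<circ> local_rep c d id) (at (snd c x)) v =
      dmap d c id x (dmap c d id x v)"
    using frechet_derivative_chain[OF transition_differentiable[OF A c d x], of "local_rep d c id" v]
      transition_differentiable[OF A d c x(2,1)] by (simp add: p dmap_def)
  moreover have "frechet_derivative (local_rep d c id \<circ> local_rep c d id) (at (snd c x)) =
      frechet_derivative (\<lambda>p. p) (at (snd c x))"
    by (rule frechet_derivative_cong_open[OF op])
       (use x in \<open>auto simp: local_rep_def chart_cinv[OF ch(1)] chart_cinv[OF ch(2)]\<close>)
  ultimately show ?thesis by simp
qed

section \<open>The product with a line\<close>

definition line_chart :: "('a, 'e) chart \<Rightarrow> ('a \<times> real, 'e \<times> real) chart" where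
  "line_chart c = (fst c \<times> UNIV, map_prod (snd c) id)"

lemma fst_line_chart [simp]: "fst (line_chart c) = fst c \<times> UNIV"
  by (simp add: line_chart_def)

lemma snd_line_chart [simp]: "snd (line_chart c) (y, t) = (snd c y, t)"
  by (simp add: line_chart_def)

lemma times_line_eq: "times_line A = line_chart ` A"
  unfolding times_line_def prod_atlas_def interval_atlas_def image_def
  by (simp add: line_chart_def Bex_def) blast

lemma range_line_chart: "snd (line_chart c) ` (fst c \<times> UNIV) = (snd c ` fst c) \<times> UNIV"
  by (force simp: line_chart_def)

lemma is_chart_line_chart:
  assumes "is_chart c"
  shows "is_chart (line_chart c)"
  using assms unfolding is_chart_def fst_line_chart range_line_chart
  by (auto simp: inj_on_def open_Times)

lemma cinv_line_chart:
  assumes "is_chart c" "a \<in> snd c ` fst c"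
  shows "cinv (line_chart c) (a, t) = (cinv c a, t)"
  using is_chart_line_chart[OF assms(1)] chart_cinv[OF assms(1)] assms(2)
  unfolding cinv_def[of "line_chart c"] is_chart_def
  by (intro inv_into_f_eq) auto

lemma has_derivative_comp_fst:
  assumes "f differentiable (at (fst p))"
  shows "((\<lambda>p. f (fst p)) has_derivative (\<lambda>V. frechet_derivative f (at (fst p)) (fst V))) (at p)"
  by (rule has_derivative_compose[OF has_derivative_fst[OF has_derivative_ident]])
     (rule has_derivative_frechet[OF assms])

lemma linear_minus_line_coordinate:
  fixes U :: "'e::real_normed_vector \<Rightarrow> real"
  assumes U: "twice_differentiable_on T U"
  shows "twice_differentiable_on (T \<times> UNIV) (\<lambda>p. U (fst p) - snd p)"
    and "a \<in> T \<Longrightarrow> frechet_derivative (\<lambda>p. U (fst p) - snd p) (at (a, t)) V =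
      frechet_derivative U (at a) (fst V) - snd V"
    and "a \<in> T \<Longrightarrow> second_deriv (\<lambda>p. U (fst p) - snd p) (a, t) V W = second_deriv U a (fst V) (fst W)"
proof -
  note D = twice_differentiable_onD[OF U]
  have op: "open (T \<times> (UNIV :: real set))" by (intro open_Times D(1) open_UNIV)
  have d1: "((\<lambda>p. U (fst p) - snd p) has_derivative (\<lambda>V. frechet_derivative U (at (fst p)) (fst V) - snd V)) (at p)"
    if "p \<in> T \<times> UNIV" for p
    using that by (intro has_derivative_diff has_derivative_comp_fst D(2) has_derivative_snd has_derivative_ident) auto
  note e1 = frechet_derivative_eqI[OF d1]
  have d2: "((\<lambda>p. frechet_derivative (\<lambda>p. U (fst p) - snd p) (at p) W) has_derivative
      (\<lambda>V. second_deriv U (fst p) (fst V) (fst W))) (at p)" if p: "p \<in> T \<times> UNIV" for p W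
  proof (rule has_derivative_transform_within_open[OF _ op p])
    show "((\<lambda>p. frechet_derivative U (at (fst p)) (fst W) - snd W) has_derivative
      (\<lambda>V. second_deriv U (fst p) (fst V) (fst W))) (at p)"
      using has_derivative_diff[OF has_derivative_comp_fst[OF D(3)] has_derivative_const[of "snd W"]] p
      by (auto simp: second_deriv_def)
  qed (simp add: e1)
  show "twice_differentiable_on (T \<times> UNIV) (\<lambda>p. U (fst p) - snd p)"
    unfolding twice_differentiable_on_def differentiable_def using op d1 d2 by blast
  show "frechet_derivative (\<lambda>p. U (fst p) - snd p) (at (a, t)) V = frechet_derivative U (at a) (fst V) - snd V"
    if "a \<in> T" using that by (simp add: e1)
  show "second_deriv (\<lambda>p. U (fst p) - snd p) (a, t) V W = second_deriv U a (fst V) (fst W)" if "a \<in> T"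
    unfolding second_deriv_def[of "\<lambda>p. U (fst p) - snd p"]
    using frechet_derivative_eqI[OF d2] that by simp
qed

lemma finite_basis_times_line:
  fixes E :: "'e::real_vector set"
  assumes E: "finite_basis E"
  obtains E' :: "('e \<times> real) set" where "finite_basis E'"
proof (rule finite_basis_exists)
  let ?B = "(\<lambda>v. (v, 0 :: real)) ` E \<union> {(0, 1)}"
  show "finite ?B" using finite_basisD(1)[OF E] by simp
  have "(a, t) \<in> span ?B" for a :: 'e and t
  proof -
    have "linear (\<lambda>v :: 'e. (v, 0 :: real))" by (rule linearI) auto
    then have "span ((\<lambda>v. (v, 0 :: real)) ` E) = (\<lambda>v. (v, 0)) ` UNIV"
      using finite_basisD(3)[OF E] by (metis linear_span_image)
    then have "(a, 0) \<in> span ?B"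
      using real_vector.span_mono[of "(\<lambda>v. (v, 0 :: real)) ` E" ?B] by blast
    moreover have "t *\<^sub>R (0, 1) \<in> span ?B"
      by (intro real_vector.span_scale real_vector.span_base) simp
    ultimately have "(a, 0) + t *\<^sub>R (0, 1) \<in> span ?B" by (rule real_vector.span_add)
    then show ?thesis by simp
  qed
  then show "span ?B = UNIV" by auto
qed

text \<open>
  The product metric is defined by pulling back \<open>g\<close> through an arbitrarily chosen chart. The
  transformation law of \<open>g\<close> makes it \<open>g + \<epsilon>' dt\<^sup>2\<close> in the product of any given chart with the
  line. Its coefficients do not depend on the coordinate of the line, hence the connection of the
  product is that of \<open>g\<close> in the first factor and trivial in the second.
\<close>

locale product_chart = metric_chart A g c E
  for A :: "('a, 'e::real_normed_vector) chart set" and g c E +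
  fixes \<epsilon>' :: real
  assumes atlas: "smooth_atlas A" and \<epsilon>': "\<epsilon>' \<noteq> 0"
begin

abbreviation "k \<equiv> times_line_metric A g \<epsilon>'"

lemma open_line: "open ((snd c ` fst c) \<times> (UNIV :: real set))"
  by (intro open_Times open_chart open_UNIV)

lemma dmap_fst:
  assumes d: "d \<in> A" and x: "x \<in> fst c" "x \<in> fst d"
  shows "dmap (line_chart c) d fst (x, t) V = dmap c d id x (fst V)"
proof -
  note sm = transition_differentiable[OF atlas c(1) d x]
  have "dmap (line_chart c) d fst (x, t) V =
      frechet_derivative (\<lambda>p. local_rep c d id (fst p)) (at (snd c x, t)) V"
    unfolding dmap_def snd_line_chart
    by (rule fun_cong[OF frechet_derivative_cong_open[OF open_line]])
       (use x in \<open>auto simp: local_rep_def cinv_line_chart[OF c(2)] chart_cinv[OF c(2)]\<close>)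
  also have "\<dots> = dmap c d id x (fst V)"
    using frechet_derivative_eqI[OF has_derivative_comp_fst[of "local_rep c d id" "(snd c x, t)"]] sm
    by (simp add: dmap_def)
  finally show ?thesis .
qed

lemma dmap_snd:
  assumes x: "x \<in> fst c"
  shows "dmap (line_chart c) (UNIV, id) snd (x, t) V = snd V"
proof -
  have "dmap (line_chart c) (UNIV, id) snd (x, t) V = frechet_derivative snd (at (snd c x, t)) V"
    unfolding dmap_def snd_line_chart
    by (rule fun_cong[OF frechet_derivative_cong_open[OF open_line]])
       (use x in \<open>auto simp: local_rep_def cinv_line_chart[OF c(2)] chart_cinv[OF c(2)]\<close>)
  also have "\<dots> = snd V"
    by (intro fun_cong[OF frechet_derivative_eqI] has_derivative_snd has_derivative_ident)
  finally show ?thesis .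
qed

lemma times_line_metric_eq:
  assumes x: "x \<in> fst c"
  shows "k (line_chart c) (x, t) V W = g c x (fst V) (fst W) + \<epsilon>' * snd V * snd W"
proof -
  define d where "d = (SOME d. d \<in> A \<and> fst (x, t) \<in> fst d)"
  have d: "d \<in> A" "x \<in> fst d"
    using someI[of "\<lambda>d. d \<in> A \<and> fst (x, t) \<in> fst d" c] c(1) x by (auto simp: d_def)
  have "pullback A g fst (line_chart c) (x, t) V W =
      g d x (dmap c d id x (fst V)) (dmap c d id x (fst W))"
    unfolding pullback_def pullback_at_def d_def[symmetric] dmap_fst[OF d(1) x d(2)] by simp
  also have "\<dots> = g c x (fst V) (fst W)"
    using metric c(1) d x unfolding pseudo_riemannian_metric_def by (metis IntI)
  finally have 1: "pullback A g fst (line_chart c) (x, t) V W = g c x (fst V) (fst W)" .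
  have "(SOME d. d \<in> interval_atlas UNIV \<and> snd (x, t) \<in> fst d) = (UNIV, id)"
    by (rule some_equality) (auto simp: interval_atlas_def)
  then have "pullback (interval_atlas UNIV) (line_metric \<epsilon>') snd (line_chart c) (x, t) V W = \<epsilon>' * snd V * snd W"
    unfolding pullback_def pullback_at_def by (simp add: dmap_snd[OF x] line_metric_def)
  with 1 show ?thesis by (simp add: times_line_metric_def)
qed

lemma scalar_product_times_line:
  assumes x: "x \<in> fst c"
  shows "scalar_product (k (line_chart c) (x, t))"
proof -
  note b = scalar_product_metric[OF x]
  note lin = scalar_product_linear[OF b]
  have "V = 0" if "\<And>W. k (line_chart c) (x, t) V W = 0" for V
  proof -
    have "g c x (fst V) w = g c x 0 w" for w
      using that[of "(w, 0)"] by (simp add: times_line_metric_eq[OF x] linear_0[OF lin(2)])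
    then have "fst V = 0" by (rule scalar_product_eqI[OF b])
    moreover have "snd V = 0"
      using that[of "(0, 1)"] \<epsilon>' by (simp add: times_line_metric_eq[OF x] linear_0[OF lin(1)])
    ultimately show ?thesis by (simp add: prod_eq_iff)
  qed
  moreover have "linear (k (line_chart c) (x, t) V)" for V
    by (rule linearI) (simp_all add: times_line_metric_eq[OF x] linear_add[OF lin(1)]
      linear_scale[OF lin(1)] algebra_simps)
  moreover have "linear (\<lambda>V. k (line_chart c) (x, t) V W)" for W
    by (rule linearI) (simp_all add: times_line_metric_eq[OF x] linear_add[OF lin(2)]
      linear_scale[OF lin(2)] algebra_simps)
  moreover have "k (line_chart c) (x, t) V W = k (line_chart c) (x, t) W V" for V W
    unfolding times_line_metric_eq[OF x] using scalar_product_sym[OF b, of "fst V" "fst W"] by simp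
  ultimately show ?thesis
    unfolding scalar_product_def bilinear_def nondegenerate_on_def by blast
qed

lemma metric_deriv_times_line:
  assumes x: "x \<in> fst c"
  shows "metric_deriv k (line_chart c) (x, t) U V W = metric_deriv g c x (fst U) (fst V) (fst W)"
proof -
  have p: "snd c x \<in> snd c ` fst c" using x by simp
  have "metric_deriv k (line_chart c) (x, t) U V W =
      frechet_derivative (\<lambda>p. g c (cinv c (fst p)) (fst V) (fst W) + \<epsilon>' * snd V * snd W) (at (snd c x, t)) U"
    unfolding metric_deriv_def snd_line_chart
    by (rule fun_cong[OF frechet_derivative_cong_open[OF open_line]])
       (use x in \<open>auto simp: cinv_line_chart[OF c(2)] chart_cinv[OF c(2)] times_line_metric_eq\<close>)
  also have "\<dots> = metric_deriv g c x (fst U) (fst V) (fst W)"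
    using frechet_derivative_eqI[OF has_derivative_add[OF has_derivative_comp_fst[of
          "\<lambda>a. g c (cinv c a) (fst V) (fst W)" "(snd c x, t)"] has_derivative_const[of "\<epsilon>' * snd V * snd W"]]]
      metric_differentiable[OF p]
    by (simp add: metric_deriv_def)
  finally show ?thesis .
qed

lemma christoffel_times_line:
  assumes x: "x \<in> fst c"
  shows "christoffel k (line_chart c) (x, t) V W = (christoffel g c x (fst V) (fst W), 0)"
proof -
  have eq: "k (line_chart c) (x, t) (christoffel g c x (fst V) (fst W), 0) Z =
      (metric_deriv k (line_chart c) (x, t) V W Z + metric_deriv k (line_chart c) (x, t) W V Z -
        metric_deriv k (line_chart c) (x, t) Z V W) / 2" for Z
    by (simp add: times_line_metric_eq[OF x] metric_deriv_times_line[OF x] metric_christoffel[OF x])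
  show ?thesis
    unfolding christoffel_def[of k]
  proof (rule the_equality, intro allI eq)
    fix Y
    assume "\<forall>Z. k (line_chart c) (x, t) Y Z =
      (metric_deriv k (line_chart c) (x, t) V W Z + metric_deriv k (line_chart c) (x, t) W V Z -
        metric_deriv k (line_chart c) (x, t) Z V W) / 2"
    then show "Y = (christoffel g c x (fst V) (fst W), 0)"
      by (intro scalar_product_eqI[OF scalar_product_times_line[OF x, of t]]) (simp only: eq)
  qed
qed

text \<open>
  The graph of \<open>u\<close> is the zero set of \<open>u y - s\<close>; this function has the same Hessian as \<open>u\<close>, since
  the coordinate of the line is affine.
\<close>

context
  fixes u :: "'a \<Rightarrow> real"
  assumes u: "twice_differentiable_on (snd c ` fst c) (u \<circ> cinv c)"
begin

lemma height_comp_cinv: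
  "p \<in> (snd c ` fst c) \<times> UNIV \<Longrightarrow>
    (u \<circ> cinv c) (fst p) - snd p = ((\<lambda>(y, s). u y - s) \<circ> cinv (line_chart c)) p"
  by (auto simp: cinv_line_chart[OF c(2)] chart_cinv[OF c(2)])

lemma twice_differentiable_height:
  "twice_differentiable_on ((snd c ` fst c) \<times> UNIV) ((\<lambda>(y, s). u y - s) \<circ> cinv (line_chart c))"
  by (rule twice_differentiable_on_cong[OF linear_minus_line_coordinate(1)[OF u] height_comp_cinv])

lemma deriv_height:
  assumes x: "x \<in> fst c"
  shows "frechet_derivative ((\<lambda>(y, s). u y - s) \<circ> cinv (line_chart c)) (at (snd c x, t)) V =
    frechet_derivative (u \<circ> cinv c) (at (snd c x)) (fst V) - snd V"
proof -
  have "frechet_derivative (\<lambda>p. (u \<circ> cinv c) (fst p) - snd p) (at (snd c x, t)) =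
      frechet_derivative ((\<lambda>(y, s). u y - s) \<circ> cinv (line_chart c)) (at (snd c x, t))"
    by (rule frechet_derivative_cong_open[OF open_line _ height_comp_cinv]) (use x in auto)
  then show ?thesis
    using linear_minus_line_coordinate(2)[OF u, of "snd c x" t V] x by simp
qed

lemma hess_height:
  assumes x: "x \<in> fst c"
  shows "hess k (line_chart c) (\<lambda>(y, s). u y - s) (x, t) V W = hess g c u x (fst V) (fst W)"
proof -
  have "second_deriv (\<lambda>p. (u \<circ> cinv c) (fst p) - snd p) (snd c x, t) =
      second_deriv ((\<lambda>(y, s). u y - s) \<circ> cinv (line_chart c)) (snd c x, t)"
    by (rule second_deriv_cong_open[OF open_line _ height_comp_cinv]) (use x in auto)
  then have "second_deriv ((\<lambda>(y, s). u y - s) \<circ> cinv (line_chart c)) (snd c x, t) V W =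
      second_deriv (u \<circ> cinv c) (snd c x) (fst V) (fst W)"
    using linear_minus_line_coordinate(3)[OF u, of "snd c x" t V W] x by simp
  then show ?thesis
    by (simp add: hess_def christoffel_times_line[OF x] deriv_height[OF x])
qed

end

end

section \<open>Composition with a function of one variable\<close>

lemma deriv_of_twice_differentiable:
  fixes f :: "real \<Rightarrow> real"
  assumes f: "twice_differentiable_on I f" and s: "s \<in> I"
  shows "frechet_derivative f (at s) a = deriv f s * a"
    and "second_deriv f s a b = deriv (deriv f) s * a * b"
proof -
  note D = twice_differentiable_onD[OF f]
  have d1: "frechet_derivative f (at t) a = deriv f t * a" if "t \<in> I" for t a
    using D(2)[OF that] by (intro fun_cong[OF frechet_derivative_eqI])
      (simp add: DERIV_deriv_iff_real_differentiable[symmetric] has_field_derivative_def)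
  then show "frechet_derivative f (at s) a = deriv f s * a" using s by simp
  have "deriv f differentiable (at s)"
    by (rule differentiable_transform_within_open[OF D(3)[OF s, of 1] D(1) s]) (simp add: d1)
  then have "((\<lambda>t. deriv f t * b) has_derivative (\<lambda>a. deriv (deriv f) s * a * b)) (at s)"
    by (intro has_derivative_mult_left)
       (simp add: DERIV_deriv_iff_real_differentiable[symmetric] has_field_derivative_def)
  then have "frechet_derivative (\<lambda>t. deriv f t * b) (at s) = (\<lambda>a. deriv (deriv f) s * a * b)"
    by (rule frechet_derivative_eqI)
  moreover have "frechet_derivative (\<lambda>t. frechet_derivative f (at t) b) (at s) =
      frechet_derivative (\<lambda>t. deriv f t * b) (at s)"
    by (rule frechet_derivative_cong_open[OF D(1) s]) (simp add: d1)
  ultimately show "second_deriv f s a b = deriv (deriv f) s * a * b"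
    by (simp add: second_deriv_def)
qed

lemma comp_real_function:
  fixes f :: "real \<Rightarrow> real"
  assumes f: "twice_differentiable_on I f" and P: "twice_differentiable_on (snd c ` fst c) (P \<circ> cinv c)"
    and c: "is_chart c" and PI: "\<And>y. y \<in> fst c \<Longrightarrow> P y \<in> I"
  shows "twice_differentiable_on (snd c ` fst c) ((f \<circ> P) \<circ> cinv c)"
    and "x \<in> fst c \<Longrightarrow> frechet_derivative ((f \<circ> P) \<circ> cinv c) (at (snd c x)) v =
      deriv f (P x) * frechet_derivative (P \<circ> cinv c) (at (snd c x)) v"
    and "x \<in> fst c \<Longrightarrow> hess g c (f \<circ> P) x v w =
      deriv (deriv f) (P x) * frechet_derivative (P \<circ> cinv c) (at (snd c x)) v *
        frechet_derivative (P \<circ> cinv c) (at (snd c x)) w + deriv f (P x) * hess g c P x v w"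
proof -
  have E: "finite_basis (Basis :: real set)"
    unfolding finite_basis_def using finite_Basis independent_Basis span_Basis by blast
  have sub: "(P \<circ> cinv c) p \<in> I" if "p \<in> snd c ` fst c" for p
    using PI chart_cinv(3)[OF c that] by simp
  show "twice_differentiable_on (snd c ` fst c) ((f \<circ> P) \<circ> cinv c)"
    unfolding comp_assoc by (rule second_deriv_comp(1)[OF E P f sub])
  assume x: "x \<in> fst c"
  then have p: "snd c x \<in> snd c ` fst c" by simp
  have Px: "(P \<circ> cinv c) (snd c x) = P x" by (simp add: chart_cinv(1)[OF c x])
  note s = PI[OF x]
  have d1: "frechet_derivative ((f \<circ> P) \<circ> cinv c) (at (snd c x)) v =
      deriv f (P x) * frechet_derivative (P \<circ> cinv c) (at (snd c x)) v" for v
  proof -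
    have "frechet_derivative (f \<circ> (P \<circ> cinv c)) (at (snd c x)) v =
        frechet_derivative f (at ((P \<circ> cinv c) (snd c x))) (frechet_derivative (P \<circ> cinv c) (at (snd c x)) v)"
      by (rule frechet_derivative_chain[OF twice_differentiable_onD(2)[OF P p] twice_differentiable_onD(2)[OF f sub[OF p]]])
    then show ?thesis
      unfolding Px comp_assoc deriv_of_twice_differentiable(1)[OF f s] .
  qed
  then show "frechet_derivative ((f \<circ> P) \<circ> cinv c) (at (snd c x)) v =
      deriv f (P x) * frechet_derivative (P \<circ> cinv c) (at (snd c x)) v" .
  have "second_deriv (f \<circ> (P \<circ> cinv c)) (snd c x) v w =
      second_deriv f ((P \<circ> cinv c) (snd c x)) (frechet_derivative (P \<circ> cinv c) (at (snd c x)) v)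
        (frechet_derivative (P \<circ> cinv c) (at (snd c x)) w) +
      frechet_derivative f (at ((P \<circ> cinv c) (snd c x))) (second_deriv (P \<circ> cinv c) (snd c x) v w)"
    by (rule second_deriv_comp(2)[OF E P f sub p])
  then have d2: "second_deriv ((f \<circ> P) \<circ> cinv c) (snd c x) v w =
      deriv (deriv f) (P x) * frechet_derivative (P \<circ> cinv c) (at (snd c x)) v *
        frechet_derivative (P \<circ> cinv c) (at (snd c x)) w +
      deriv f (P x) * second_deriv (P \<circ> cinv c) (snd c x) v w"
    unfolding Px comp_assoc deriv_of_twice_differentiable[OF f s] .
  show "hess g c (f \<circ> P) x v w =
      deriv (deriv f) (P x) * frechet_derivative (P \<circ> cinv c) (at (snd c x)) v *
        frechet_derivative (P \<circ> cinv c) (at (snd c x)) w + deriv f (P x) * hess g c P x v w"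
    unfolding hess_def d1 d2 by (simp only: right_diff_distrib add_diff_eq)
qed

section \<open>Fibres of a decomposable manifold\<close>

context decomposable
begin

lemma atlas: "smooth_atlas A"
  using manifold by (simp add: pseudo_riemannian_manifold_def smooth_manifold_def)

lemma finite_bases: "\<exists>E :: 'e set. finite_basis E" "\<exists>E :: 'n set. finite_basis E"
  using manifold quotient finite_basis_exists
  unfolding pseudo_riemannian_manifold_def smooth_manifold_def homogeneous_space_def by metis+

lemma metric: "pseudo_riemannian_metric A g"
  using manifold by (simp add: pseudo_riemannian_manifold_def)

lemma smooth_projection: "smooth_map A (interval_atlas I) \<pi>" "\<pi> ` mcarrier A = I"
  using submersion unfolding pseudo_riemannian_submersion_def
  by (simp_all add: interval_atlas_def mcarrier_def)

lemma projection_in: "x \<in> mcarrier A \<Longrightarrow> \<pi> x \<in> I"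
  using smooth_projection(2) by blast

lemma chart_subset: "c \<in> A \<Longrightarrow> x \<in> fst c \<Longrightarrow> x \<in> mcarrier A"
  by (auto simp: mcarrier_def)

lemma projection_twice_differentiable:
  assumes c: "c \<in> A"
  shows "twice_differentiable_on (snd c ` fst c) (\<pi> \<circ> cinv c)"
proof -
  have "fst c \<inter> \<pi> -` I = fst c" using projection_in chart_subset[OF c] by blast
  then have "smooth_on (snd c ` fst c) (\<pi> \<circ> cinv c)"
    using smooth_projection(1) c by (auto simp: smooth_map_def interval_atlas_def local_rep_def)
  then show ?thesis
    using smooth_atlas_is_chart[OF atlas c] by (intro smooth_on_imp_twice_differentiable_on) (auto simp: is_chart_def)
qed

lemma fibre_point:
  assumes x: "x \<in> mcarrier A"
  obtains C q where "q \<in> Q" "C \<in> fst q" "\<phi> (\<pi> x, C) = x"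
proof -
  have "mcarrier (prod_atlas (interval_atlas I) Q) \<subseteq> I \<times> mcarrier Q"
    by (auto simp: mcarrier_def prod_atlas_def interval_atlas_def)
  moreover have "\<phi> ` mcarrier (prod_atlas (interval_atlas I) Q) = mcarrier A"
    using phi_diffeo by (simp add: diffeomorphism_def bij_betw_def)
  ultimately have "mcarrier A \<subseteq> \<phi> ` (I \<times> mcarrier Q)" by blast
  then obtain s C where sC: "s \<in> I" "C \<in> mcarrier Q" "x = \<phi> (s, C)" using x by blast
  then have "\<pi> x = s" using pi_phi by simp
  moreover obtain q where "q \<in> Q" "C \<in> fst q" using sC(2) by (auto simp: mcarrier_def)
  ultimately show ?thesis using that sC by simp
qed

text \<open>
  The fibre is a level set of \<open>\<pi>\<close> with gradient of square \<open>\<epsilon>\<^sub>0\<close>, so its mean curvature vector is minus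
  \<open>\<epsilon>\<^sub>0\<close> times the trace of the Hessian of \<open>\<pi>\<close> along the fibre, in the direction of the gradient.
  Comparing it with the vector prescribed by \<open>h\<close> and the unit normal, minus the gradient, identifies
  the trace with \<open>h\<close>.
\<close>

lemma fibre_geometry:
  assumes cA: "c \<in> A" and x: "x \<in> fst c" and q: "q \<in> Q" and C: "C \<in> fst q" and \<phi>C: "\<phi> (\<pi> x, C) = x"
  defines "L \<equiv> dmap q c (\<lambda>C. \<phi> (\<pi> x, C)) C"
  shows "linear L" "scalar_product (\<lambda>v w. g c x (L v) (L w))" "g c x (grad g c \<pi> x) (L v) = 0"
    "\<exists>v s. y = L v + s *\<^sub>R grad g c \<pi> x"
    "form_trace (\<lambda>v w. g c x (L v) (L w)) (\<lambda>v w. hess g c \<pi> x (L v) (L w)) = h (\<pi> x)"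
proof -
  obtain E :: "'e set" where E: "finite_basis E" using finite_bases(1) by blast
  obtain En :: "'n set" where En: "finite_basis En" using finite_bases(2) by blast
  note chart = smooth_atlas_is_chart[OF atlas cA]
  interpret metric_chart A g c E
    by unfold_locales (fact E metric cA chart)+
  have Q: "smooth_atlas Q"
    using quotient by (simp add: homogeneous_space_def smooth_manifold_def)
  note chartq = smooth_atlas_is_chart[OF Q q]
  define \<psi> where "\<psi> = (\<lambda>C. \<phi> (\<pi> x, C))"
  define G where "G = grad g c \<pi> x"
  have L: "L = dmap q c \<psi> C" and \<psi>C: "\<psi> C = x" using \<phi>C by (simp_all add: L_def \<psi>_def)
  have s: "\<pi> x \<in> I" by (rule projection_in[OF chart_subset[OF cA x]])
  have H: "has_mean_curvature Q A g \<psi> (\<lambda>d C. - grad g d \<pi> (\<psi> C)) (\<lambda>C. h (\<pi> x))"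
    unfolding \<psi>_def by (rule fibre_mean_curvature[OF s])
  have dim: "dim (UNIV :: 'n set) + 1 = dim (UNIV :: 'e set)" and imm: "nondegenerate_immersion Q A g \<psi>"
    using H by (simp_all add: has_mean_curvature_def)
  have mem: "C \<in> fst q \<inter> \<psi> -` fst c" using C \<psi>C x by simp
  have \<psi>: "twice_differentiable_on (snd q ` (fst q \<inter> \<psi> -` fst c)) (local_rep q c \<psi>)"
    using imm q cA by (intro smooth_on_imp_twice_differentiable_on)
      (auto simp: nondegenerate_immersion_def smooth_map_def)
  have injL: "inj L" and nd: "nondegenerate_on UNIV (pullback_at g q c \<psi> C)"
    using imm q cA mem unfolding L nondegenerate_immersion_def by blast+
  note pi2 = projection_twice_differentiable[OF cA]
  have px: "snd c x \<in> snd c ` fst c" using x by simp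
  have Gd: "g c x G w = frechet_derivative (\<pi> \<circ> cinv c) (at (snd c x)) w" for w
    unfolding G_def by (rule metric_grad[OF x twice_differentiable_onD(2)[OF pi2 px]])
  have GG: "g c x G G = \<epsilon>\<^sub>0" unfolding G_def by (rule grad_sign[OF cA x])
  have \<epsilon>0: "\<epsilon>\<^sub>0 \<noteq> 0" "\<epsilon>\<^sub>0 * \<epsilon>\<^sub>0 = 1" using sign by auto
  note b = scalar_product_metric[OF x]
  note lin = scalar_product_linear[OF b]
  interpret fibre: level_set_immersion g q c \<psi> \<pi> "\<pi> x" C G E
  proof unfold_locales
    show "\<pi> (\<psi> y) = \<pi> x" if "y \<in> fst q" "\<psi> y \<in> fst c" for y
      unfolding \<psi>_def using that q by (intro pi_phi[OF s]) (auto simp: mcarrier_def)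
  qed (use E chartq chart C x \<psi> pi2 b Gd GG \<epsilon>0 in \<open>simp_all add: \<psi>C\<close>)
  show linL: "linear L" unfolding L by (rule fibre.linear_dmap)
  have normal: "g c x G (L v) = 0" for v using fibre.normal by (simp add: L \<psi>C)
  then show "g c x (grad g c \<pi> x) (L v) = 0" by (simp add: G_def)
  have GL: "G \<notin> range L" using normal GG \<epsilon>0 by auto
  have split: "\<exists>v s. y = L v + s *\<^sub>R G" for y
    by (rule hyperplane_plus_line[OF En E linL injL GL dim])
  then show "\<exists>v s. y = L v + s *\<^sub>R grad g c \<pi> x" by (simp add: G_def)
  have pb: "pullback_at g q c \<psi> C = (\<lambda>v w. g c x (L v) (L w))"
    by (intro ext) (simp add: pullback_at_def \<psi>C L)
  show "scalar_product (\<lambda>v w. g c x (L v) (L w))"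
    unfolding scalar_product_def bilinear_def
    using nd linear_compose[OF linL lin(1)] linear_compose[OF linL lin(2)]
    by (auto simp: pb o_def intro: scalar_product_sym[OF b])
  have "mean_curvature_vector g q c \<psi> C = (g c x (- G) (- G) * h (\<pi> x)) *\<^sub>R (- G)"
    using H q cA mem unfolding has_mean_curvature_def Let_def by (auto simp: \<psi>C G_def)
  also have "g c x (- G) (- G) = \<epsilon>\<^sub>0"
    by (simp add: linear_neg[OF lin(1)] linear_neg[OF lin(2)] GG)
  finally have "(- form_trace (\<lambda>v w. g c x (L v) (L w)) (\<lambda>v w. hess g c \<pi> x (L v) (L w)) / \<epsilon>\<^sub>0) *\<^sub>R G =
      (- (\<epsilon>\<^sub>0 * h (\<pi> x))) *\<^sub>R G"
    using fibre.mean_curvature_vector_eq split unfolding \<psi>C L[symmetric] pb GG by simp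
  moreover have "G \<noteq> 0" using GG \<epsilon>0 linear_0[OF lin(1)] by auto
  ultimately have "- form_trace (\<lambda>v w. g c x (L v) (L w)) (\<lambda>v w. hess g c \<pi> x (L v) (L w)) / \<epsilon>\<^sub>0 =
      - (\<epsilon>\<^sub>0 * h (\<pi> x))"
    using real_vector.scale_right_imp_eq by blast
  then show "form_trace (\<lambda>v w. g c x (L v) (L w)) (\<lambda>v w. hess g c \<pi> x (L v) (L w)) = h (\<pi> x)"
    using sign by auto
qed

end

section \<open>Graphs of functions of the submersion\<close>

lemma dt_field_line_chart: "dt_field (line_chart c) (y, t) = (0, 1)"
proof -
  have "((\<lambda>t. (snd c y, t)) has_vector_derivative (0, 1)) (at t)"
    by (intro has_vector_derivative_Pair has_vector_derivative_const has_vector_derivative_id[unfolded id_def])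
  then show ?thesis by (simp add: dt_field_def vector_derivative_at)
qed

context decomposable
begin

text \<open>
  The form is the metric \<open>g + \<epsilon>' d(f \<circ> \<pi>)\<^sup>2\<close> induced on the graph. Both for it and for \<open>g\<close> the
  gradient \<open>G\<close> of \<open>\<pi>\<close> is orthogonal to the fibres, and the two forms agree along the fibres. The
  Hessian of \<open>f \<circ> \<pi>\<close> is \<open>f'' d\<pi>\<^sup>2 + f' Hess \<pi>\<close>: the direction of \<open>G\<close>, where \<open>Hess \<pi>\<close> vanishes,
  contributes the first summand of the trace and the fibre the second one.
\<close>

lemma graph_metric_hessian_trace:
  fixes f :: "real \<Rightarrow> real" and \<epsilon>' :: real
  defines "p c x \<equiv> frechet_derivative (\<pi> \<circ> cinv c) (at (snd c x))"
  assumes \<epsilon>': "\<epsilon>' \<in> {1, -1}" and f: "twice_differentiable_on I f"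
    and nz: "\<epsilon>' + \<epsilon>\<^sub>0 * (deriv f (\<pi> x))\<^sup>2 \<noteq> 0"
    and cA: "c \<in> A" and x: "x \<in> fst c"
  shows "scalar_product (\<lambda>v w. g c x v w + \<epsilon>' * (deriv f (\<pi> x))\<^sup>2 * p c x v * p c x w)"
    and "form_trace (\<lambda>v w. g c x v w + \<epsilon>' * (deriv f (\<pi> x))\<^sup>2 * p c x v * p c x w) (hess g c (f \<circ> \<pi>) x) =
      deriv (deriv f) (\<pi> x) / (\<epsilon>\<^sub>0 + \<epsilon>' * (deriv f (\<pi> x))\<^sup>2) + deriv f (\<pi> x) * h (\<pi> x)"
proof -
  obtain E :: "'e set" where E: "finite_basis E" using finite_bases(1) by blast
  obtain En :: "'n set" where En: "finite_basis En" using finite_bases(2) by blast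
  note chart = smooth_atlas_is_chart[OF atlas cA]
  interpret metric_chart A g c E
    by unfold_locales (fact E metric cA chart)+
  note pi2 = projection_twice_differentiable[OF cA]
  have px: "snd c x \<in> snd c ` fst c" using x by simp
  define G where "G = grad g c \<pi> x"
  define P where "P = p c x"
  define f1 where "f1 = deriv f (\<pi> x)"
  define \<gamma> where "\<gamma> v w = g c x v w + \<epsilon>' * f1\<^sup>2 * P v * P w" for v w
  note b = scalar_product_metric[OF x]
  note lin = scalar_product_linear[OF b]
  have GP: "g c x G w = P w" for w
    unfolding G_def P_def p_def by (rule metric_grad[OF x twice_differentiable_onD(2)[OF pi2 px]])
  have GG: "g c x G G = \<epsilon>\<^sub>0" unfolding G_def by (rule grad_sign[OF cA x])
  have PG: "P G = \<epsilon>\<^sub>0" using GP GG by metis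
  have linP: "linear P"
    unfolding P_def p_def by (rule linear_frechet_derivative[OF twice_differentiable_onD(2)[OF pi2 px]])
  have \<epsilon>0: "\<epsilon>\<^sub>0 * \<epsilon>\<^sub>0 = 1" "\<epsilon>\<^sub>0 \<noteq> 0" using sign by auto
  define \<delta> where "\<delta> = \<epsilon>\<^sub>0 + \<epsilon>' * f1\<^sup>2"
  have \<delta>: "\<delta> \<noteq> 0"
    using nz sign \<epsilon>' by (auto simp: \<delta>_def f1_def)
  have \<gamma>G: "\<gamma> v G = \<epsilon>\<^sub>0 * \<delta> * P v" for v
    using \<epsilon>0 GP[of v] scalar_product_sym[OF b, of v G] by (simp add: \<gamma>_def \<delta>_def PG algebra_simps)
  have \<gamma>: "scalar_product \<gamma>"
  proof -
    have "v = 0" if "\<And>w. \<gamma> v w = 0" for v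
    proof -
      have "P v = 0" using that[of G] \<epsilon>0 \<delta> by (simp add: \<gamma>G)
      then have "g c x v w = g c x 0 w" for w
        using that[of w] by (simp add: \<gamma>_def linear_0[OF lin(2)])
      then show ?thesis by (rule scalar_product_eqI[OF b])
    qed
    moreover have "linear (\<gamma> v)" "linear (\<lambda>v. \<gamma> v w)" for v w
      by (rule linearI; simp add: \<gamma>_def linear_add[OF lin(1)] linear_add[OF lin(2)] linear_scale[OF lin(1)]
          linear_scale[OF lin(2)] linear_add[OF linP] linear_scale[OF linP] algebra_simps)+
    moreover have "\<gamma> v w = \<gamma> w v" for v w
      using scalar_product_sym[OF b, of v w] by (simp add: \<gamma>_def)
    ultimately show ?thesis
      unfolding scalar_product_def bilinear_def nondegenerate_on_def by blast
  qed
  then show "scalar_product (\<lambda>v w. g c x v w + \<epsilon>' * (deriv f (\<pi> x))\<^sup>2 * p c x v * p c x w)"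
    unfolding \<gamma>_def[abs_def] f1_def P_def .
  have PI: "\<pi> y \<in> I" if "y \<in> fst c" for y by (rule projection_in[OF chart_subset[OF cA that]])
  note fof = comp_real_function[OF f pi2 chart PI]
  define B where "B = hess g c (f \<circ> \<pi>) x"
  have B: "B v w = deriv (deriv f) (\<pi> x) * P v * P w + f1 * hess g c \<pi> x v w" for v w
    unfolding B_def P_def p_def f1_def by (rule fof(3)[OF _ x])
  have bilB: "bilinear B" unfolding B_def by (rule bilinear_hess[OF x fof(1)])
  obtain q C where q: "q \<in> Q" "C \<in> fst q" "\<phi> (\<pi> x, C) = x"
    by (rule fibre_point[OF chart_subset[OF cA x]])
  define L where "L = dmap q c (\<lambda>C. \<phi> (\<pi> x, C)) C"
  note fib = fibre_geometry[OF cA x q, folded L_def G_def]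
  have PL: "P (L v) = 0" for v using fib(3) GP by simp
  have \<gamma>L: "\<gamma> (L v) (L w) = g c x (L v) (L w)" for v w by (simp add: \<gamma>_def PL)
  have BL: "B (L v) (L w) = hess g c \<pi> x (L v) (L w) *\<^sub>R f1" for v w by (simp add: B PL)
  have \<gamma>GG: "\<gamma> G G = \<delta>" using \<epsilon>0 by (simp add: \<gamma>G PG)
  have "form_trace \<gamma> B = form_trace (\<lambda>v w. \<gamma> (L v) (L w)) (\<lambda>v w. B (L v) (L w)) + B G G / \<gamma> G G"
  proof (rule form_trace_hyperplane_plus_line[OF En E \<gamma> _ bilB fib(1) _ _ fib(4)])
    show "scalar_product (\<lambda>v w. \<gamma> (L v) (L w))" unfolding \<gamma>L by (rule fib(2))
    show "\<gamma> G (L v) = 0" for v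
      using scalar_product_sym[OF \<gamma>, of G "L v"] by (simp add: \<gamma>G PL)
    show "\<gamma> G G \<noteq> 0" using \<delta> by (simp add: \<gamma>GG)
  qed
  also have "form_trace (\<lambda>v w. \<gamma> (L v) (L w)) (\<lambda>v w. B (L v) (L w)) = h (\<pi> x) * f1"
    unfolding \<gamma>L BL form_trace_scaleR fib(5) by simp
  also have "hess g c \<pi> x G G = 0"
    unfolding G_def by (rule hess_grad_grad[OF x pi2]) (rule grad_sign[OF cA])
  then have "B G G / \<gamma> G G = deriv (deriv f) (\<pi> x) / \<delta>"
    using \<epsilon>0 by (simp add: B PG \<gamma>GG)
  finally have "form_trace \<gamma> B = deriv (deriv f) (\<pi> x) / \<delta> + f1 * h (\<pi> x)" by simp
  then show "form_trace (\<lambda>v w. g c x v w + \<epsilon>' * (deriv f (\<pi> x))\<^sup>2 * p c x v * p c x w) (hess g c (f \<circ> \<pi>) x) =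
      deriv (deriv f) (\<pi> x) / (\<epsilon>\<^sub>0 + \<epsilon>' * (deriv f (\<pi> x))\<^sup>2) + deriv f (\<pi> x) * h (\<pi> x)"
    unfolding \<gamma>_def[abs_def] f1_def P_def B_def \<delta>_def .
qed

text \<open>
  With \<open>R (y, s) = u y - s\<close> the vector field \<open>\<partial>\<^sub>t\<close> pairs to \<open>-1\<close> with \<open>grad R\<close>. Its normal part and the
  mean curvature vector are both multiples of \<open>grad R\<close>, and comparing the coefficients leaves the
  equation that the trace of the Hessian of \<open>u\<close> with respect to the induced metric is one. The
  parametrizing chart \<open>c\<close> and the chart \<open>d\<close> of the target may differ; the coordinate change \<open>T\<close>
  between them drops out of the trace.
\<close>

lemma graph_soliton_at:
  fixes f :: "real \<Rightarrow> real" and \<epsilon>' :: real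
  defines "F \<equiv> \<lambda>x. (x, (f \<circ> \<pi>) x)" and "k \<equiv> times_line_metric A g \<epsilon>'"
  assumes pm: "\<epsilon>' \<in> {1, -1}" and f: "twice_differentiable_on I f"
    and imm: "nondegenerate_immersion A (times_line A) k F"
    and nz: "\<epsilon>' + \<epsilon>\<^sub>0 * (deriv f (\<pi> x))\<^sup>2 \<noteq> 0"
    and cA: "c \<in> A" and dA: "d \<in> A" and xc: "x \<in> fst c" and xd: "x \<in> fst d"
  shows "mean_curvature_vector k c (line_chart d) F x =
      normal_part (k (line_chart d) (F x)) (range (dmap c (line_chart d) F x)) (dt_field (line_chart d) (F x)) \<longleftrightarrow>
    deriv (deriv f) (\<pi> x) =
      (\<epsilon>\<^sub>0 + \<epsilon>' * (deriv f (\<pi> x))\<^sup>2) * (1 - deriv f (\<pi> x) * h (\<pi> x))"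
proof -
  obtain E :: "'e set" where E: "finite_basis E" using finite_bases(1) by blast
  obtain E' :: "('e \<times> real) set" where E': "finite_basis E'" by (rule finite_basis_times_line[OF E])
  note chart = smooth_atlas_is_chart[OF atlas cA] smooth_atlas_is_chart[OF atlas dA]
  have \<epsilon>'0: "\<epsilon>' * \<epsilon>' = 1" "\<epsilon>' \<noteq> 0" using pm by auto
  interpret product_chart A g d E \<epsilon>'
    by unfold_locales (fact E metric dA chart(2) atlas \<epsilon>'0(2))+
  note pi2 = projection_twice_differentiable[OF dA]
  have px: "snd d x \<in> snd d ` fst d" using xd by simp
  have PI: "\<pi> y \<in> I" if "y \<in> fst d" for y by (rule projection_in[OF chart_subset[OF dA that]])
  define u where "u = f \<circ> \<pi>"
  note fof = comp_real_function[OF f pi2 chart(2) PI, folded u_def]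
  define G where "G = grad g d \<pi> x"
  define P where "P = frechet_derivative (\<pi> \<circ> cinv d) (at (snd d x))"
  define f1 where "f1 = deriv f (\<pi> x)"
  define D where "D = \<epsilon>' + \<epsilon>\<^sub>0 * f1\<^sup>2"
  have D: "D \<noteq> 0" using nz by (simp add: D_def f1_def)
  note b = scalar_product_metric[OF xd]
  note lin = scalar_product_linear[OF b]
  have GP: "g d x G w = P w" for w
    unfolding G_def P_def by (rule metric_grad[OF xd twice_differentiable_onD(2)[OF pi2 px]])
  have PG: "P G = \<epsilon>\<^sub>0" using GP grad_sign[OF dA xd] unfolding G_def by metis
  have linP: "linear P"
    unfolding P_def by (rule linear_frechet_derivative[OF twice_differentiable_onD(2)[OF pi2 px]])
  have Du: "frechet_derivative (u \<circ> cinv d) (at (snd d x)) v = f1 * P v" for v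
    unfolding P_def f1_def by (rule fof(2)[OF _ xd])
  have Fx: "F x = (x, u x)" by (simp add: F_def u_def)
  have kx: "k (line_chart d) (x, t) V W = g d x (fst V) (fst W) + \<epsilon>' * snd V * snd W" for t V W
    unfolding k_def by (rule times_line_metric_eq[OF xd])
  define \<tau> where "\<tau> = local_rep c d id"
  define T where "T = dmap c d id x"
  note trans = transition_differentiable[OF atlas cA dA xc xd, folded \<tau>_def]
  have linT: "linear T" unfolding T_def dmap_def \<tau>_def[symmetric] by (rule linear_frechet_derivative[OF trans])
  have inv: "dmap d c id x (T v) = v" "T (dmap d c id x v) = v" for v
    unfolding T_def by (rule dmap_transition_inverse[OF atlas cA dA xc xd] dmap_transition_inverse[OF atlas dA cA xd xc])+
  have injT: "inj T" by (metis injI inv(1))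
  have surjT: "surj T" by (metis surjI inv(2))
  have vim: "fst c \<inter> F -` (fst d \<times> UNIV) = fst c \<inter> fst d" by (auto simp: F_def)
  have lc: "line_chart d \<in> times_line A" using dA by (simp add: times_line_eq)
  have sm: "open (snd c ` (fst c \<inter> fst d))" "smooth_on (snd c ` (fst c \<inter> fst d)) (local_rep c (line_chart d) F)"
    using imm cA lc unfolding nondegenerate_immersion_def smooth_map_def by (auto simp: vim dest!: bspec)
  have twF: "twice_differentiable_on (snd c ` (fst c \<inter> fst d)) (local_rep c (line_chart d) F)"
    by (rule smooth_on_imp_twice_differentiable_on[OF sm])
  have dF: "dmap c (line_chart d) F x v = (T v, f1 * P (T v))" for v
  proof -
    have \<tau>x: "\<tau> (snd c x) = snd d x" by (simp add: \<tau>_def local_rep_def chart_cinv[OF chart(1)] xc)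
    have d\<tau>: "(\<tau> has_derivative T) (at (snd c x))"
      using has_derivative_frechet[OF trans] by (simp add: T_def dmap_def \<tau>_def)
    have du: "((u \<circ> cinv d) has_derivative (\<lambda>v. f1 * P v)) (at (\<tau> (snd c x)))"
      using has_derivative_frechet[OF twice_differentiable_onD(2)[OF fof(1) px]] unfolding \<tau>x Du[abs_def]
      by (simp add: Du[abs_def])
    have "((\<lambda>p. (\<tau> p, (u \<circ> cinv d) (\<tau> p))) has_derivative (\<lambda>v. (T v, f1 * P (T v)))) (at (snd c x))"
      by (rule has_derivative_Pair[OF d\<tau> has_derivative_compose[OF d\<tau> du]])
    then have "(local_rep c (line_chart d) F has_derivative (\<lambda>v. (T v, f1 * P (T v)))) (at (snd c x))"
      by (rule has_derivative_transform_within_open[OF _ sm(1)])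
         (use xc xd in \<open>auto simp: local_rep_def F_def \<tau>_def u_def chart_cinv[OF chart(1)] chart_cinv[OF chart(2)]\<close>)
    then show ?thesis unfolding dmap_def by (simp add: frechet_derivative_eqI)
  qed
  \<comment> \<open>the gradient of \<open>u y - s\<close> for the product metric, as \<open>\<epsilon>'\<close> is its own inverse\<close>
  define N where "N = (f1 *\<^sub>R G, - \<epsilon>')"
  have kN: "k (line_chart d) (x, t) N W = f1 * P (fst W) - snd W" for t W
    using \<epsilon>'0 by (simp add: kx N_def linear_scale[OF lin(2)] GP mult.assoc[symmetric])
  have kNN: "k (line_chart d) (x, t) N N = D" for t
    by (simp add: kN, simp add: N_def linear_scale[OF linP] PG D_def power2_eq_square)
  let ?R = "\<lambda>(y, s). u y - s"
  interpret graph: level_set_immersion k c "line_chart d" F ?R 0 x N E'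
  proof unfold_locales
    show "finite_basis E'" by (rule E')
    show "is_chart c" "is_chart (line_chart d)" by (rule chart is_chart_line_chart)+
    show "x \<in> fst c" "F x \<in> fst (line_chart d)" using xc xd by (simp_all add: Fx)
    show "twice_differentiable_on (snd c ` (fst c \<inter> F -` fst (line_chart d))) (local_rep c (line_chart d) F)"
      using twF by (simp add: vim)
    show "twice_differentiable_on (snd (line_chart d) ` fst (line_chart d)) (?R \<circ> cinv (line_chart d))"
      unfolding fst_line_chart range_line_chart by (rule twice_differentiable_height[OF fof(1)])
    show "?R (F y) = 0" for y by (simp add: F_def u_def)
    show "scalar_product (k (line_chart d) (F x))"
      unfolding k_def Fx by (rule scalar_product_times_line[OF xd])
    show "k (line_chart d) (F x) N w = frechet_derivative (?R \<circ> cinv (line_chart d)) (at (snd (line_chart d) (F x))) w" for w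
      unfolding Fx snd_line_chart kN
      using deriv_height[OF fof(1) xd, of "u x" w, unfolded Du] by (rule sym)
    show "k (line_chart d) (F x) N N \<noteq> 0" unfolding Fx kNN by (rule D)
  qed
  have split: "\<exists>v s. y = dmap c (line_chart d) F x v + s *\<^sub>R N" for y
  proof -
    obtain a t where y: "y = (a, t)" by (cases y)
    \<comment> \<open>The first component forces \<open>T v = a - s f1 G\<close>; the second is then a linear equation for \<open>s\<close>
      with coefficient \<open>D\<close>.\<close>
    define s where "s = (f1 * P a - t) / D"
    define v where "v = dmap d c id x (a - (s * f1) *\<^sub>R G)"
    have Tv: "T v = a - (s * f1) *\<^sub>R G" by (simp add: v_def inv)
    have "s * D = f1 * P a - t" using D by (simp add: s_def)
    then have "t = f1 * P (T v) - s * \<epsilon>'"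
      by (simp add: Tv linear_diff[OF linP] linear_scale[OF linP] PG D_def power2_eq_square algebra_simps)
    then have "y = dmap c (line_chart d) F x v + s *\<^sub>R N"
      unfolding dF by (simp add: y N_def Tv)
    then show ?thesis by blast
  qed
  define \<gamma> where "\<gamma> v w = g d x v w + \<epsilon>' * f1\<^sup>2 * P v * P w" for v w
  note tr = graph_metric_hessian_trace[OF pm f nz dA xd, folded f1_def P_def u_def, folded \<gamma>_def]
  have "pullback_at k c (line_chart d) F x = (\<lambda>v w. \<gamma> (T v) (T w))"
    by (intro ext) (simp add: pullback_at_def Fx kx dF \<gamma>_def power2_eq_square)
  moreover have "hess k (line_chart d) ?R (F x) (dmap c (line_chart d) F x v) (dmap c (line_chart d) F x w) =
      hess g d u x (T v) (T w)" for v w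
    using hess_height[OF fof(1) xd, of "u x" "(T v, f1 * P (T v))" "(T w, f1 * P (T w))"]
    unfolding k_def Fx dF fst_conv .
  moreover have "form_trace (\<lambda>v w. \<gamma> (T v) (T w)) (\<lambda>v w. hess g d u x (T v) (T w)) =
      form_trace \<gamma> (hess g d u x)"
    by (rule form_trace_comp[OF E E _ bilinear_hess[OF xd fof(1)] linT injT surjT])
       (use tr(1) in \<open>simp add: \<gamma>_def[abs_def]\<close>)
  ultimately have "mean_curvature_vector k c (line_chart d) F x = (- form_trace \<gamma> (hess g d u x) / D) *\<^sub>R N"
    using graph.mean_curvature_vector_eq[OF split] by (simp add: Fx kNN)
  moreover have "k (line_chart d) (x, u x) (0, 1) N = - 1"
    using \<epsilon>'0 by (simp add: kx N_def linear_0[OF lin(2)])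
  then have "normal_part (k (line_chart d) (F x)) (range (dmap c (line_chart d) F x)) (dt_field (line_chart d) (F x)) =
      (- 1 / D) *\<^sub>R N"
    unfolding graph.normal_part_eq[OF split] by (simp add: Fx dt_field_line_chart kNN)
  moreover have "N \<noteq> 0" using \<epsilon>'0 by (simp add: N_def zero_prod_def)
  ultimately have "mean_curvature_vector k c (line_chart d) F x =
      normal_part (k (line_chart d) (F x)) (range (dmap c (line_chart d) F x)) (dt_field (line_chart d) (F x)) \<longleftrightarrow>
      form_trace \<gamma> (hess g d u x) = 1"
    using D by simp
  moreover have "form_trace \<gamma> (hess g d u x) =
      deriv (deriv f) (\<pi> x) / (\<epsilon>\<^sub>0 + \<epsilon>' * f1\<^sup>2) + f1 * h (\<pi> x)"
    using tr(2) by (simp add: \<gamma>_def[abs_def])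
  moreover have "\<epsilon>\<^sub>0 + \<epsilon>' * f1\<^sup>2 \<noteq> 0"
    using D sign pm by (auto simp: D_def)
  then have "deriv (deriv f) (\<pi> x) / (\<epsilon>\<^sub>0 + \<epsilon>' * f1\<^sup>2) + f1 * h (\<pi> x) = 1 \<longleftrightarrow>
      deriv (deriv f) (\<pi> x) = (\<epsilon>\<^sub>0 + \<epsilon>' * f1\<^sup>2) * (1 - f1 * h (\<pi> x))"
    by (auto simp: field_simps)
  ultimately show ?thesis by (simp add: f1_def)
qed

text \<open>The orbits are the fibres of \<open>\<pi>\<close>, so functions of \<open>\<pi>\<close> are invariant.\<close>

lemma graph_invariant: "invariant_graph G act (mcarrier A) (\<lambda>x. (x, (f \<circ> \<pi>) x))"
  unfolding invariant_graph_def
proof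
  fix \<sigma> assume \<sigma>: "\<sigma> \<in> carrier G"
  have "group_action G (mcarrier A) act" using action by (simp add: proper_smooth_action_def)
  then have surj: "act \<sigma> ` mcarrier A = mcarrier A" by (rule group_action.surj_prop[OF _ \<sigma>])
  have inv: "\<pi> (act \<sigma> x) = \<pi> x" if "x \<in> mcarrier A" for x
    using fibres[OF that] \<sigma> by (auto simp: orbit_def)
  have "(\<lambda>(x, t). (act \<sigma> x, t)) ` (\<lambda>x. (x, (f \<circ> \<pi>) x)) ` mcarrier A =
      (\<lambda>x. (x, (f \<circ> \<pi>) x)) ` act \<sigma> ` mcarrier A"
    unfolding image_image by (rule image_cong) (simp_all add: inv)
  then show "(\<lambda>(x, t). (act \<sigma> x, t)) ` (\<lambda>x. (x, (f \<circ> \<pi>) x)) ` mcarrier A =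
      (\<lambda>x. (x, (f \<circ> \<pi>) x)) ` mcarrier A"
    by (simp only: surj)
qed

end

theorem theorem3p1:
  fixes A :: "('a, 'e::real_normed_vector) chart set"
    and g :: "('a, 'e) metric"
    and S :: "('s, 'l::real_normed_vector) chart set"
    and G :: "('s, 'z) monoid_scheme"
    and act :: "'s \<Rightarrow> 'a \<Rightarrow> 'a"
    and I :: "real set"
    and \<pi> :: "'a \<Rightarrow> real"
    and \<epsilon>\<^sub>0 \<epsilon>' \<epsilon> :: real
    and h f :: "real \<Rightarrow> real"
    and x\<^sub>0 :: 'a
    and \<beta> :: "real \<Rightarrow> 'a"
    and Q :: "('s set, 'n::real_normed_vector) chart set"
    and \<phi> :: "real \<times> 's set \<Rightarrow> 'a"
    and u :: "'a \<Rightarrow> real"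
    and F :: "'a \<Rightarrow> 'a \<times> real"
  assumes "decomposable A g S G act I \<pi> \<epsilon>\<^sub>0 h x\<^sub>0 \<beta> Q \<phi>"
    and "\<epsilon>' \<in> {1, -1}"
    and "smooth_on I f"
    and "u = f \<circ> \<pi>"
    and "F = (\<lambda>x. (x, u x))"
    and "nondegenerate_immersion A (times_line A) (times_line_metric A g \<epsilon>') F"
    and "\<epsilon> \<in> {1, -1}"
    and "\<And>x. x \<in> mcarrier A \<Longrightarrow> sgn (\<epsilon>' + \<epsilon>\<^sub>0 * (deriv f (\<pi> x))\<^sup>2) = \<epsilon>"
  shows "translating_soliton A A g \<epsilon>' F \<and> invariant_graph G act (mcarrier A) F \<longleftrightarrow>
    (\<forall>s\<in>I. deriv (deriv f) s =
       (\<epsilon>\<^sub>0 + \<epsilon>' * (deriv f s)\<^sup>2) * (1 - deriv f s * h s))"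
proof -
  interpret decomposable A g S G act I \<pi> \<epsilon>\<^sub>0 h x\<^sub>0 \<beta> Q \<phi> by (rule assms(1))
  let ?ode = "\<lambda>s. deriv (deriv f) s = (\<epsilon>\<^sub>0 + \<epsilon>' * (deriv f s)\<^sup>2) * (1 - deriv f s * h s)"
  let ?k = "times_line_metric A g \<epsilon>'"
  let ?soliton = "\<lambda>c d x. mean_curvature_vector ?k c d F x =
    normal_part (?k d (F x)) (range (dmap c d F x)) (dt_field d (F x))"
  have F: "F = (\<lambda>x. (x, (f \<circ> \<pi>) x))" using assms(4,5) by simp
  have f: "twice_differentiable_on I f"
    by (rule smooth_on_imp_twice_differentiable_on[OF interval(1) assms(3)])
  have nz: "\<epsilon>' + \<epsilon>\<^sub>0 * (deriv f (\<pi> x))\<^sup>2 \<noteq> 0" if "x \<in> mcarrier A" for x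
    using assms(7) assms(8)[OF that] by auto
  have at: "?soliton c (line_chart d) x \<longleftrightarrow> ?ode (\<pi> x)"
    if "c \<in> A" "d \<in> A" "x \<in> fst c" "x \<in> fst d" for c d x
    using graph_soliton_at[OF assms(2) f assms(6)[unfolded F] nz[OF chart_subset[OF that(1,3)]] that]
    unfolding F .
  have "translating_soliton A A g \<epsilon>' F \<longleftrightarrow> (\<forall>x\<in>mcarrier A. ?ode (\<pi> x))"
  proof
    assume sol: "translating_soliton A A g \<epsilon>' F"
    show "\<forall>x\<in>mcarrier A. ?ode (\<pi> x)"
    proof
      fix x assume "x \<in> mcarrier A"
      then obtain c where c: "c \<in> A" "x \<in> fst c" by (auto simp: mcarrier_def)
      then have "?soliton c (line_chart c) x"
        using sol unfolding translating_soliton_def by (auto simp: times_line_eq F)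
      then show "?ode (\<pi> x)" using at[OF c(1) c(1) c(2) c(2)] by blast
    qed
  next
    assume ode: "\<forall>x\<in>mcarrier A. ?ode (\<pi> x)"
    have "?soliton c d x" if cd: "c \<in> A" "d \<in> times_line A" "x \<in> fst c \<inter> F -` fst d" for c d x
    proof -
      obtain d0 where d0: "d0 \<in> A" "d = line_chart d0" using cd(2) by (auto simp: times_line_eq)
      then have "x \<in> fst c" "x \<in> fst d0" using cd(3) by (auto simp: F)
      then show ?thesis using at[OF cd(1) d0(1)] ode chart_subset[OF cd(1)] d0(2) by blast
    qed
    then show "translating_soliton A A g \<epsilon>' F"
      unfolding translating_soliton_def using assms(6) by blast
  qed
  also have "\<dots> \<longleftrightarrow> (\<forall>s\<in>I. ?ode s)"
    using smooth_projection(2) by blast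
  finally show ?thesis
    using graph_invariant[of f] unfolding F by blast
qed

end
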